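(* Let $N\ge2$, let $X$ be a complex Fréchet space, and let $T_1,\dots,T_N\in\mathfrak L(X)$. Assume there exist a holomorphic map $E:O\to X$ defined on a connected open set $O\subset\mathbb C$, and non-constant holomorphic functions $\phi_1,\dots,\phi_N$ defined on a connected open set containing $O$, such that: the closed linear span of $E(O)$ is $X$; $T_iE(z)=\phi_i(z)E(z)$ for every $i=1,\dots,N$ and every $z\in O$; and $O\cap\phi_i^{-1}(\mathbb T)\cap\bigcap_{j\ne i}\phi_j^{-1}(\mathbb D)\ne\emptyset$ for every $i=1,\dots,N$. Then $(T_1,\dots,T_N)$ is densely $d$-frequently hypercyclic.
   Context: $\mathbb D$ is the open unit disk and $\mathbb T$ the unit circle. A vector $x$ is $d$-frequently hypercyclic for $(T_1,\dots,T_N)$ if for every non-empty open $W\subset X^N$ the set $\{n\in\mathbb N:(T_1^nx,\dots,T_N^nx)\in W\}$ has positive lower density; the tuple is densely $d$-frequently hypercyclic if the set of such vectors is dense in $X$. *)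

theory Defs
  imports "HOL-Analysis.Analysis"
begin

text \<open>A complex Frechet space: the carrier is a type with an additive group structure and a
complete metric; the complex scalar multiplication is given explicitly as sm.
We require: sm makes the type a complex vector space, the metric is translation
invariant (so completeness is completeness of the TVS), addition and scalar
multiplication are jointly continuous, and the topology is locally convex.\<close>

definition frechet_space :: "(complex \<Rightarrow> 'a::{ab_group_add,complete_space} \<Rightarrow> 'a) \<Rightarrow> bool" where
  "frechet_space sm \<longleftrightarrow>
     vector_space sm \<and>
     (\<forall>x y z::'a. dist (x + z) (y + z) = dist x y) \<and>
     continuous_on UNIV (\<lambda>p::'a \<times> 'a. fst p + snd p) \<and>
     continuous_on UNIV (\<lambda>p::complex \<times> 'a. sm (fst p) (snd p)) \<and>
     (\<forall>W. open W \<and> (0::'a) \<in> W \<longrightarrow>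
        (\<exists>V. open V \<and> 0 \<in> V \<and> V \<subseteq> W \<and>
             (\<forall>x\<in>V. \<forall>y\<in>V. \<forall>t::real. 0 \<le> t \<and> t \<le> 1 \<longrightarrow>
                 sm (complex_of_real t) x + sm (complex_of_real (1 - t)) y \<in> V)))"

definition cont_lin_op :: "(complex \<Rightarrow> 'a::{ab_group_add,topological_space} \<Rightarrow> 'a) \<Rightarrow> ('a \<Rightarrow> 'a) \<Rightarrow> bool" where
  "cont_lin_op sm T \<longleftrightarrow> Vector_Spaces.linear sm sm T \<and> continuous_on UNIV T"

definition vholomorphic_on :: "(complex \<Rightarrow> 'a::{ab_group_add,topological_space} \<Rightarrow> 'a) \<Rightarrow> (complex \<Rightarrow> 'a) \<Rightarrow> complex set \<Rightarrow> bool" where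
  "vholomorphic_on sm E Om \<longleftrightarrow>
     (\<forall>z\<in>Om. \<exists>D. ((\<lambda>h. sm (inverse h) (E (z + h) - E z)) \<longlongrightarrow> D) (at 0))"

definition lower_density :: "nat set \<Rightarrow> ereal" where
  "lower_density A = liminf (\<lambda>n. ereal (real (card (A \<inter> {1..n})) / real n))"

definition d_freq_hypercyclic_vec :: "nat \<Rightarrow> (nat \<Rightarrow> 'a::topological_space \<Rightarrow> 'a) \<Rightarrow> 'a \<Rightarrow> bool" where
  "d_freq_hypercyclic_vec N T x \<longleftrightarrow>
     (\<forall>W. openin (product_topology (\<lambda>_. euclidean) {1..N}) W \<and> W \<noteq> {} \<longrightarrow>
        lower_density {n. restrict (\<lambda>i. (T i ^^ n) x) {1..N} \<in> W} > 0)"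

definition densely_d_freq_hypercyclic :: "nat \<Rightarrow> (nat \<Rightarrow> 'a::topological_space \<Rightarrow> 'a) \<Rightarrow> bool" where
  "densely_d_freq_hypercyclic N T \<longleftrightarrow> closure {x. d_freq_hypercyclic_vec N T x} = UNIV"

end

theory Submission
  imports Defs "HOL-Complex_Analysis.Complex_Analysis"
begin

text \<open>Near a point where \<open>\<phi> i\<close> is unimodular and the other \<open>\<phi> j\<close> lie in the disc, a local coordinate
  \<open>\<gamma>\<close> turns \<open>\<phi> i\<close> into \<open>exp (\<i> z)\<close>, so the vectors
  \<open>v n = \<integral> exp (\<i> n t) (t - a)\<^sup>2 (t - b)\<^sup>2 E (\<gamma> t) dt\<close> over short real intervals satisfy
  \<open>T i (v n) = v (n + 1)\<close>. Two integrations by parts give \<open>v n = O(1 / n\<^sup>2)\<close>, and applying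
  \<open>T j\<close> \<open>m\<close> times with \<open>j \<noteq> i\<close> gains a further factor \<open>r ^ m\<close> with \<open>r < 1\<close>. Thus \<open>v (- n)\<close> is
  a backward orbit of \<open>v 0\<close> under \<open>T i\<close> which every other \<open>T j\<close> makes negligible. For each \<open>i\<close> the
  vectors \<open>v 0\<close> span a dense subspace by the identity theorem. Adding, over the indices \<open>n\<close> of
  well separated sets of positive lower density, backward orbits of a dense sequence of \<open>N\<close>-tuples
  of such vectors produces a disjoint frequently hypercyclic vector; adding to it a combination of
  vectors \<open>v 0\<close>, whose orbits tend to zero under all the operators, gives density.

  Vector-valued integrals are handled weakly: by the Hahn--Banach theorem a vector is small as soon
  as all functionals that are bounded by \<open>M\<close> on a suitable compact set are small on it, so that
  every estimate reduces to one for scalar holomorphic functions.\<close>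

section \<open>The Hahn--Banach theorem\<close>

text \<open>The index sets are dictated by density and separation alone, so smallness of the sums
  must hold for arbitrary sets of indices and for all powers \<open>m\<close> simultaneously. Decay
  of order 1 / n^2 is summable along any such set, which is why two integrations by parts are
  arranged. The operators see the vectors \<open>v (- n)\<close> in two ways. The power
  \<open>T i ^^ m\<close> shifts the frequency to m - n, so only the distance between
  \<open>m\<close> and \<open>n\<close> counts. For j different from i the frequency stays - n and
  the gain is \<open>r ^ m\<close>, so smallness needs either \<open>m\<close> large or all
  \<open>n\<close> large. This accounts for the two kinds of conditions in
  \<open>adapted_family\<close>, and for index sets in which every element is large and any two
  elements are far apart, both relative to their levels. The given unimodular point may be critical
  for \<open>\<phi> i\<close>, and then no coordinate exists there; a nearby point must be used.
  Since the topology need not come from one norm, the decay constant has to be independent of the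
  functional, which enters only through its bound \<open>M\<close> on one compact set.\<close>

locale complex_vector_space = vector_space sm
  for sm :: "complex \<Rightarrow> 'a::ab_group_add \<Rightarrow> 'a"
begin

text \<open>Only real positive scalars occur: the Hahn-Banach argument runs over the underlying real
  space and is complexified at the end. The inequality for \<open>r\<close> improves to an equality
  by using it again for \<open>inverse r\<close>.\<close>

definition sublinear :: "('a \<Rightarrow> real) \<Rightarrow> bool" where
  "sublinear q \<longleftrightarrow> (\<forall>x y. q (x + y) \<le> q x + q y) \<and>
     (\<forall>r>0. \<forall>x. q (sm (of_real r) x) \<le> r * q x)"

lemma sublinear_add: "sublinear q \<Longrightarrow> q (x + y) \<le> q x + q y"
  by (simp add: sublinear_def)

lemma sublinear_scale:
  assumes "sublinear q" "r > 0"
  shows "q (sm (of_real r) x) = r * q x"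
proof (rule antisym)
  show "q (sm (of_real r) x) \<le> r * q x"
    using assms by (simp add: sublinear_def)
  have "q (sm (of_real (inverse r)) (sm (of_real r) x)) \<le> inverse r * q (sm (of_real r) x)"
    using assms unfolding sublinear_def by (metis inverse_positive_iff_positive)
  moreover have "sm (of_real (inverse r)) (sm (of_real r) x) = x"
    using assms by (simp add: scale_scale)
  ultimately show "r * q x \<le> q (sm (of_real r) x)"
    using assms by (simp add: field_simps)
qed

lemma sublinear_0: "sublinear q \<Longrightarrow> q 0 = 0"
  using sublinear_scale[of q 2 0] by simp

lemma sublinear_uminus: "sublinear q \<Longrightarrow> - q (- x) \<le> q x"
  using sublinear_add[of q x "- x"] sublinear_0[of q] by simp

text \<open>A minimal sublinear \<open>q\<close> coincides with \<open>lower_along q y\<close> for every \<open>y\<close>, which forces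
  \<open>q (- y) = - q y\<close>. Hence minimal sublinear functions are linear, and Zorn's lemma provides them.\<close>

definition lower_along :: "('a \<Rightarrow> real) \<Rightarrow> 'a \<Rightarrow> 'a \<Rightarrow> real" where
  "lower_along q y x = (INF r\<in>{0..}. q (x + sm (of_real r) y) - r * q y)"

text \<open>Writing r y as (x + r y) + (- x) and using subadditivity gives a lower bound free of
  \<open>r\<close>, so the infimum in \<open>lower_along\<close> is finite.\<close>

lemma lower_along_bound:
  assumes "sublinear q" "r \<ge> 0"
  shows "- q (- x) \<le> q (x + sm (of_real r) y) - r * q y"
proof -
  have "r * q y = q (sm (of_real r) y)"
    using assms sublinear_scale[of q r y] sublinear_0[of q] by (cases "r = 0") auto
  also have "\<dots> = q ((x + sm (of_real r) y) + (- x))" by simp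
  also have "\<dots> \<le> q (x + sm (of_real r) y) + q (- x)"
    by (rule sublinear_add[OF assms(1)])
  finally show ?thesis by simp
qed

lemma lower_along_le:
  assumes "sublinear q" "r \<ge> 0"
  shows "lower_along q y x \<le> q (x + sm (of_real r) y) - r * q y"
  unfolding lower_along_def
  by (rule cINF_lower) (use assms lower_along_bound in \<open>auto intro!: bdd_belowI2\<close>)

lemma lower_along_greatest:
  assumes "\<And>r. r \<ge> 0 \<Longrightarrow> c \<le> q (x + sm (of_real r) y) - r * q y"
  shows "c \<le> lower_along q y x"
  unfolding lower_along_def by (rule cINF_greatest) (use assms in auto)

lemma sublinear_lower_along:
  assumes q: "sublinear q"
  shows "sublinear (lower_along q y)"
  unfolding sublinear_def
proof (intro conjI allI impI)
  fix x1 x2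
  \<comment> \<open>The parameters of the two infima are independent; their sum \<open>r + s\<close>
    is the parameter used for \<open>x1 + x2\<close>. The infima are then taken one after the
    other.\<close>
  have *: "lower_along q y (x1 + x2) \<le>
      (q (x1 + sm (of_real r) y) - r * q y) + (q (x2 + sm (of_real s) y) - s * q y)"
    if "r \<ge> 0" "s \<ge> 0" for r s
  proof -
    have "lower_along q y (x1 + x2) \<le> q (x1 + x2 + sm (of_real (r + s)) y) - (r + s) * q y"
      using that by (intro lower_along_le q) auto
    also have "x1 + x2 + sm (of_real (r + s)) y = (x1 + sm (of_real r) y) + (x2 + sm (of_real s) y)"
      by (simp add: scale_left_distrib algebra_simps)
    also have "q \<dots> \<le> q (x1 + sm (of_real r) y) + q (x2 + sm (of_real s) y)"
      by (rule sublinear_add[OF q])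
    finally show ?thesis by (simp add: algebra_simps)
  qed
  have "lower_along q y (x1 + x2) - (q (x2 + sm (of_real s) y) - s * q y) \<le> lower_along q y x1"
    if "s \<ge> 0" for s
    using *[OF _ that] by (intro lower_along_greatest) (simp add: algebra_simps)
  then have "lower_along q y (x1 + x2) - lower_along q y x1 \<le> lower_along q y x2"
    by (intro lower_along_greatest) (simp add: algebra_simps)
  then show "lower_along q y (x1 + x2) \<le> lower_along q y x1 + lower_along q y x2" by simp
next
  fix r :: real and x assume r: "r > 0"
  have "inverse r * lower_along q y (sm (of_real r) x) \<le> lower_along q y x"
  proof (rule lower_along_greatest)
    fix s :: real assume s: "s \<ge> 0"
    have "lower_along q y (sm (of_real r) x)
        \<le> q (sm (of_real r) x + sm (of_real (r * s)) y) - r * s * q y"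
      using r s by (intro lower_along_le q) auto
    also have "sm (of_real r) x + sm (of_real (r * s)) y = sm (of_real r) (x + sm (of_real s) y)"
      by (simp add: scale_right_distrib)
    also have "q \<dots> = r * q (x + sm (of_real s) y)" by (rule sublinear_scale[OF q r])
    finally show "inverse r * lower_along q y (sm (of_real r) x) \<le> q (x + sm (of_real s) y) - s * q y"
      using r by (simp add: field_simps)
  qed
  then show "lower_along q y (sm (of_real r) x) \<le> r * lower_along q y x"
    using r by (simp add: field_simps)
qed

lemma minimal_sublinear_odd:
  assumes q: "sublinear q" and min: "\<And>q'. sublinear q' \<Longrightarrow> q' \<le> q \<Longrightarrow> q' = q"
  shows "q (- y) = - q y"
proof -
  have "lower_along q y \<le> q"
  proof (rule le_funI)
    show "lower_along q y x \<le> q x" for x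
      using lower_along_le[OF q, of 0 y x] by simp
  qed
  then have "lower_along q y = q" by (intro min sublinear_lower_along q)
  \<comment> \<open>The parameter 1 at the point \<open>- y\<close> produces q 0 - q y.\<close>
  then have "q (- y) \<le> - q y"
    using lower_along_le[OF q, of 1 y "- y"] sublinear_0[OF q] by simp
  with sublinear_uminus[OF q, of y] show ?thesis by simp
qed

text \<open>Zorn's lemma for the reversed pointwise order. A chain is bounded by its pointwise
  infimum, finite because q \<le> p implies - p (- x) \<le> - q (- x) \<le> q x. Subadditivity
  survives because two members of a chain can both be replaced by the smaller one.\<close>

lemma minimal_sublinear_exists:
  assumes p: "sublinear p"
  obtains q where "sublinear q" "q \<le> p" "\<And>q'. sublinear q' \<Longrightarrow> q' \<le> q \<Longrightarrow> q' = q"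
proof -
  define A where "A = {q. sublinear q \<and> q \<le> p}"
  define P where "P = (\<lambda>a b :: 'a \<Rightarrow> real. b \<le> a)"
  have "\<exists>m\<in>A. \<forall>a\<in>A. P m a \<longrightarrow> a = m"
  proof (rule predicate_Zorn)
    show "partial_order_on A (relation_of P A)"
      by (rule partial_order_on_relation_ofI) (auto simp: P_def)
    fix C assume C: "C \<in> Chains (relation_of P A)"
    have CA: "C \<subseteq> A" using C by (auto simp: Chains_def relation_of_def)
    have tot: "a \<le> b \<or> b \<le> a" if "a \<in> C" "b \<in> C" for a b
      using C that by (auto simp: Chains_def relation_of_def P_def)
    show "\<exists>u\<in>A. \<forall>a\<in>C. P a u"
    proof (cases "C = {}")
      case True
      then show ?thesis using p by (auto simp: A_def)
    next
      case False
      define u where "u = (\<lambda>x. INF q\<in>C. q x)"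
      have low: "- p (- x) \<le> q x" if "q \<in> C" for q x
      proof -
        have "sublinear q" "q \<le> p" using that CA by (auto simp: A_def)
        then show ?thesis using sublinear_uminus[of q x] by (auto dest: le_funD[of q p "- x"])
      qed
      have u_le: "u x \<le> q x" if "q \<in> C" for q x
        unfolding u_def by (rule cINF_lower) (use low that in \<open>auto intro!: bdd_belowI2\<close>)
      have u_gr: "c \<le> u x" if "\<And>q. q \<in> C \<Longrightarrow> c \<le> q x" for c x
        unfolding u_def by (rule cINF_greatest) (use False that in auto)
      have "sublinear u"
        unfolding sublinear_def
      proof (intro conjI allI impI)
        fix x y
        have *: "u (x + y) \<le> q1 x + q2 y" if "q1 \<in> C" "q2 \<in> C" for q1 q2
        proof -
          have "q1 \<le> q2 \<or> q2 \<le> q1" using tot that by blast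
          then obtain q where q: "q \<in> C" "q \<le> q1" "q \<le> q2" using \<open>q1 \<in> C\<close> \<open>q2 \<in> C\<close> by auto
          have "u (x + y) \<le> q (x + y)" by (rule u_le[OF q(1)])
          also have "\<dots> \<le> q x + q y" using q(1) CA by (intro sublinear_add) (auto simp: A_def)
          also have "\<dots> \<le> q1 x + q2 y" using q by (intro add_mono) (auto simp: le_fun_def)
          finally show ?thesis .
        qed
        have "u (x + y) - q2 y \<le> u x" if "q2 \<in> C" for q2
          using *[OF _ that] by (intro u_gr) (simp add: algebra_simps)
        then have "u (x + y) - u x \<le> u y" by (intro u_gr) (simp add: algebra_simps)
        then show "u (x + y) \<le> u x + u y" by simp
      next
        fix r :: real and x assume r: "r > 0"
        have "inverse r * u (sm (of_real r) x) \<le> u x"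
        proof (rule u_gr)
          fix q assume q: "q \<in> C"
          have "u (sm (of_real r) x) \<le> q (sm (of_real r) x)" by (rule u_le[OF q])
          also have "\<dots> \<le> r * q x" using q CA r by (auto simp: A_def sublinear_def)
          finally show "inverse r * u (sm (of_real r) x) \<le> q x" using r by (simp add: field_simps)
        qed
        then show "u (sm (of_real r) x) \<le> r * u x" using r by (simp add: field_simps)
      qed
      moreover have "u \<le> p"
      proof -
        obtain q where "q \<in> C" using False by auto
        then have "u \<le> q" "q \<le> p" using u_le CA by (auto simp: le_fun_def A_def)
        then show ?thesis by (rule order_trans)
      qed
      ultimately show ?thesis
        using u_le by (auto simp: A_def P_def le_fun_def)
    qed
  qed
  then obtain m where m: "m \<in> A" "\<And>a. a \<in> A \<Longrightarrow> a \<le> m \<Longrightarrow> a = m" by (auto simp: P_def)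
  show ?thesis
  proof (rule that[of m])
    show "q' = m" if "sublinear q'" "q' \<le> m" for q'
      using m that by (auto simp: A_def intro: order_trans)
  qed (use m in \<open>auto simp: A_def\<close>)
qed

text \<open>Complex homogeneity forces Im (l x) = - Re (l (i x)), so a real-linear \<open>u\<close>
  is the real part of exactly this complex-linear map.\<close>

lemma linear_complexification:
  assumes add: "\<And>x y. u (x + y) = u x + u y"
    and sc: "\<And>r x. u (sm (of_real r) x) = r * u x"
  shows "Vector_Spaces.linear sm (*) (\<lambda>x. Complex (u x) (- u (sm \<i> x)))"
proof -
  have lin: "u (sm c x) = Re c * u x + Im c * u (sm \<i> x)" for c x
  proof -
    have "sm c x = sm (of_real (Re c)) x + sm (of_real (Im c)) (sm \<i> x)"
      by (metis complex_eq mult.commute scale_left_distrib scale_scale)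
    then show ?thesis by (simp only: add sc)
  qed
  show ?thesis
  proof (unfold_locales)
    fix x y
    show "Complex (u (x + y)) (- u (sm \<i> (x + y))) =
        Complex (u x) (- u (sm \<i> x)) + Complex (u y) (- u (sm \<i> y))"
      by (simp add: scale_right_distrib add complex_eq_iff)
  next
    fix c x
    have "u (sm \<i> (sm c x)) = Re c * u (sm \<i> x) - Im c * u x"
      using lin[of "\<i> * c" x] by simp
    then show "Complex (u (sm c x)) (- u (sm \<i> (sm c x))) = c * Complex (u x) (- u (sm \<i> x))"
      by (simp add: lin[of c x] complex_eq_iff)
  qed
qed

text \<open>Zorn's lemma is started below \<open>lower_along p v\<close> instead of
  \<open>p\<close>. This yields q (- v) \<le> - p v, and oddness of the minimal \<open>q\<close>
  turns it into equality with \<open>p\<close> at the prescribed vector \<open>v\<close>.\<close>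

theorem hahn_banach:
  assumes p: "sublinear p"
  obtains l where "Vector_Spaces.linear sm (*) l" "\<And>x. Re (l x) \<le> p x" "Re (l v) = p v"
proof -
  obtain q where q: "sublinear q" "q \<le> lower_along p v"
    "\<And>q'. sublinear q' \<Longrightarrow> q' \<le> q \<Longrightarrow> q' = q"
    using minimal_sublinear_exists[OF sublinear_lower_along[OF p]] by blast
  note odd = minimal_sublinear_odd[OF q(1,3)]
  have le: "q x \<le> p x" for x
    using le_funD[OF q(2), of x] lower_along_le[OF p, of 0 v x] by simp
  have "q (- v) \<le> - p v"
    using le_funD[OF q(2), of "- v"] lower_along_le[OF p, of 1 v "- v"] sublinear_0[OF p] by simp
  then have v: "q v = p v" using odd[of v] le[of v] by simp
  have add: "q (x + y) = q x + q y" for x y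
  proof (rule antisym)
    have "q (- (x + y)) \<le> q (- x) + q (- y)"
      using sublinear_add[OF q(1), of "- x" "- y"] by simp
    then show "q x + q y \<le> q (x + y)" by (simp only: odd)
  qed (rule sublinear_add[OF q(1)])
  have sc: "q (sm (of_real r) x) = r * q x" for r x
  proof (cases r "0 :: real" rule: linorder_cases)
    case less
    have "q (sm (of_real (- r)) x) = - r * q x" using less by (intro sublinear_scale q) auto
    then show ?thesis by (simp add: odd)
  qed (auto simp: sublinear_0[OF q(1)] sublinear_scale[OF q(1)])
  show ?thesis
    by (rule that[OF linear_complexification[OF add sc]]) (simp_all add: le v)
qed

end

section \<open>Continuous functionals on Frechet spaces\<close>

locale frechet = complex_vector_space sm
  for sm :: "complex \<Rightarrow> 'a::{ab_group_add,complete_space} \<Rightarrow> 'a" +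
  assumes frechet: "frechet_space sm"
begin

lemma dist_add_right [simp]: "dist (x + z) (y + z :: 'a) = dist x y"
  using frechet by (simp add: frechet_space_def)

lemma dist_add_left [simp]: "dist (z + x) (z + y :: 'a) = dist x y"
  using dist_add_right[of x z y] by (simp add: add.commute)

lemma dist_diff_0: "dist (x - y) (0 :: 'a) = dist x y"
  using dist_add_right[of "x - y" y 0] by simp

lemma dist_add_0_le: "dist (x + y) (0 :: 'a) \<le> dist x 0 + dist y 0"
proof -
  have "dist (x + y) 0 \<le> dist (x + y) y + dist y 0" by (rule dist_triangle)
  also have "dist (x + y) y = dist x 0" using dist_add_right[of x y 0] by simp
  finally show ?thesis .
qed

lemma dist_sum_0_le: "dist (\<Sum>i\<in>I. f i) (0 :: 'a) \<le> (\<Sum>i\<in>I. dist (f i) 0)"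
proof (induction I rule: infinite_finite_induct)
  case (insert i I)
  then show ?case using dist_add_0_le[of "f i" "\<Sum>i\<in>I. f i"] by simp
qed simp_all

lemma continuous_on_plus:
  fixes f g :: "'b::topological_space \<Rightarrow> 'a"
  assumes "continuous_on S f" "continuous_on S g"
  shows "continuous_on S (\<lambda>x. f x + g x)"
proof -
  have "continuous_on UNIV (\<lambda>p::'a \<times> 'a. fst p + snd p)"
    using frechet by (simp add: frechet_space_def)
  from continuous_on_compose2[OF this continuous_on_Pair[OF assms]] show ?thesis by simp
qed

lemma continuous_on_sm:
  fixes g :: "'b::topological_space \<Rightarrow> 'a"
  assumes "continuous_on S f" "continuous_on S g"
  shows "continuous_on S (\<lambda>x. sm (f x) (g x))"
proof -
  have "continuous_on UNIV (\<lambda>p::complex \<times> 'a. sm (fst p) (snd p))"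
    using frechet by (simp add: frechet_space_def)
  from continuous_on_compose2[OF this continuous_on_Pair[OF assms]] show ?thesis by simp
qed

lemma continuous_on_diff':
  fixes f g :: "'b::topological_space \<Rightarrow> 'a"
  assumes "continuous_on S f" "continuous_on S g"
  shows "continuous_on S (\<lambda>x. f x - g x)"
  using continuous_on_plus[OF assms(1) continuous_on_sm[OF continuous_on_const[of _ "-1"] assms(2)]]
  by simp

lemma tendsto_plus:
  fixes f g :: "'b \<Rightarrow> 'a"
  assumes "(f \<longlongrightarrow> a) F" "(g \<longlongrightarrow> b) F"
  shows "((\<lambda>x. f x + g x) \<longlongrightarrow> a + b) F"
proof -
  have "isCont (\<lambda>p::'a \<times> 'a. fst p + snd p) (a, b)"
    using frechet by (simp add: frechet_space_def continuous_on_eq_continuous_at)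
  from isCont_tendsto_compose[OF this tendsto_Pair[OF assms]] show ?thesis by simp
qed

lemma tendsto_sm:
  fixes g :: "'b \<Rightarrow> 'a"
  assumes "(f \<longlongrightarrow> c) F" "(g \<longlongrightarrow> x) F"
  shows "((\<lambda>x. sm (f x) (g x)) \<longlongrightarrow> sm c x) F"
proof -
  have "isCont (\<lambda>p::complex \<times> 'a. sm (fst p) (snd p)) (c, x)"
    using frechet by (simp add: frechet_space_def continuous_on_eq_continuous_at)
  from isCont_tendsto_compose[OF this tendsto_Pair[OF assms]] show ?thesis by simp
qed

definition functional :: "('a \<Rightarrow> complex) \<Rightarrow> bool" where
  "functional l \<longleftrightarrow> Vector_Spaces.linear sm (*) l \<and> continuous_on UNIV l"

lemma functional_add: "functional l \<Longrightarrow> l (x + y) = l x + l y"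
  and functional_scale: "functional l \<Longrightarrow> l (sm c x) = c * l x"
  unfolding functional_def by (auto simp: Vector_Spaces.linear_iff)

lemma functional_0: "functional l \<Longrightarrow> l 0 = 0"
  using functional_scale[of l 0 0] by simp

lemma functional_diff: "functional l \<Longrightarrow> l (x - y) = l x - l y"
  using functional_add[of l "x - y" y] by simp

lemma functional_sum: "functional l \<Longrightarrow> l (\<Sum>i\<in>I. f i) = (\<Sum>i\<in>I. l (f i))"
  by (induction I rule: infinite_finite_induct) (simp_all add: functional_add functional_0)

lemma functional_tendsto: "functional l \<Longrightarrow> (f \<longlongrightarrow> x) F \<Longrightarrow> ((\<lambda>t. l (f t)) \<longlongrightarrow> l x) F"
  unfolding functional_def by (metis UNIV_I continuous_on_eq_continuous_at isCont_tendsto_compose open_UNIV)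

lemma functional_bounded:
  assumes lin: "Vector_Spaces.linear sm (*) l" and W: "open W" "(0::'a) \<in> W"
    and bd: "\<And>x. x \<in> W \<Longrightarrow> norm (l x) \<le> B"
  shows "functional l"
proof -
  have add: "l (x + y) = l x + l y" and sc: "l (sm c x) = c * l x" for x y c
    using lin by (auto simp: Vector_Spaces.linear_iff)
  have diff: "l (x - y) = l x - l y" for x y using add[of "x - y" y] by simp
  have "isCont l x0" for x0
    unfolding isCont_def
  proof (rule tendstoI)
    fix e :: real assume e: "e > 0"
    have "norm (l 0) \<le> B" by (rule bd[OF W(2)])
    then have "B \<ge> 0" by (meson norm_ge_zero order_trans)
    \<comment> \<open>With this factor, membership of c (x - x0) in \<open>W\<close> gives (B + 1) /
      e * |l x - l x0| \<le> B. The added 1 makes the resulting inequality strict and covers B =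
      0.\<close>
    define c where "c = complex_of_real ((B + 1) / e)"
    have cont: "continuous_on UNIV (\<lambda>x. sm c (x - x0))"
      by (intro continuous_on_sm continuous_on_diff' continuous_on_const continuous_on_id)
    have "open ((\<lambda>x. sm c (x - x0)) -` W)"
      using cont W(1) by (simp add: continuous_on_open_vimage)
    moreover have "x0 \<in> (\<lambda>x. sm c (x - x0)) -` W" using W by simp
    moreover have "dist (l x) (l x0) < e" if "x \<in> (\<lambda>x. sm c (x - x0)) -` W" for x
    proof -
      have "norm (l (sm c (x - x0))) \<le> B" using that by (intro bd) auto
      then have "(B + 1) / e * norm (l x - l x0) \<le> B"
        using e \<open>B \<ge> 0\<close> by (simp add: sc diff norm_mult c_def del: of_real_divide of_real_add)
      then have "(B + 1) * norm (l x - l x0) < (B + 1) * e"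
        using e \<open>B \<ge> 0\<close> by (simp add: field_simps)
      then show ?thesis using \<open>B \<ge> 0\<close> by (simp add: dist_norm)
    qed
    ultimately show "\<forall>\<^sub>F x in at x0. dist (l x) (l x0) < e"
      unfolding eventually_at_topological by blast
  qed
  then show ?thesis
    using lin by (simp add: functional_def continuous_on_eq_continuous_at)
qed

section \<open>Convex neighbourhoods, Minkowski gauges and separation\<close>

definition convex_set :: "'a set \<Rightarrow> bool" where
  "convex_set V \<longleftrightarrow> (\<forall>x\<in>V. \<forall>y\<in>V. \<forall>t::real. 0 \<le> t \<and> t \<le> 1 \<longrightarrow>
     sm (complex_of_real t) x + sm (complex_of_real (1 - t)) y \<in> V)"

lemma convex_nhd:
  assumes "open W" "(0::'a) \<in> W"
  obtains V where "open V" "0 \<in> V" "V \<subseteq> W" "convex_set V"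
proof -
  have "\<exists>V. open V \<and> 0 \<in> V \<and> V \<subseteq> W \<and> convex_set V"
    using frechet assms unfolding frechet_space_def convex_set_def by blast
  then show ?thesis using that by blast
qed

text \<open>The Minkowski functional. The convex sets in question need not be balanced, so it is
  sublinear but in general not a seminorm.\<close>

definition gauge_of :: "'a set \<Rightarrow> 'a \<Rightarrow> real" where
  "gauge_of V x = Inf {t. 0 < t \<and> sm (of_real (inverse t)) x \<in> V}"

context
  fixes V :: "'a set"
  assumes V: "open V" "0 \<in> V" "convex_set V"
begin

lemma convex_shrink:
  assumes "x \<in> V" "0 \<le> t" "t \<le> 1"
  shows "sm (of_real t) x \<in> V"
  using V assms unfolding convex_set_def by (metis add.right_neutral scale_zero_right)

lemma gauge_set_nonempty: "{t. 0 < t \<and> sm (of_real (inverse t)) x \<in> V} \<noteq> {}"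
proof -
  have "((\<lambda>t::real. sm (of_real t) x) \<longlongrightarrow> sm (of_real 0) x) (at_right 0)"
    by (intro tendsto_sm tendsto_intros)
  then have "\<forall>\<^sub>F t::real in at_right 0. sm (of_real t) x \<in> V"
    using V by (auto dest!: topological_tendstoD[of _ _ _ V])
  then obtain b :: real where b: "b > 0" "\<And>t. 0 < t \<Longrightarrow> t < b \<Longrightarrow> sm (of_real t) x \<in> V"
    by (auto simp: eventually_at_right_field)
  have "inverse (b / 2) \<in> {t. 0 < t \<and> sm (of_real (inverse t)) x \<in> V}"
    using b(1) b(2)[of "b / 2"] by (simp del: of_real_divide of_real_inverse)
  then show ?thesis by blast
qed

lemma gauge_of_le: "0 < t \<Longrightarrow> sm (of_real (inverse t)) x \<in> V \<Longrightarrow> gauge_of V x \<le> t"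
  unfolding gauge_of_def by (rule cInf_lower) (auto intro!: bdd_belowI[of _ 0])

lemma gauge_of_greatest:
  "(\<And>t. 0 < t \<Longrightarrow> sm (of_real (inverse t)) x \<in> V \<Longrightarrow> c \<le> t) \<Longrightarrow> c \<le> gauge_of V x"
  unfolding gauge_of_def by (rule cInf_greatest[OF gauge_set_nonempty]) auto

lemma sublinear_gauge_of: "sublinear (gauge_of V)"
  unfolding sublinear_def
proof (intro conjI allI impI)
  fix x y
  have *: "gauge_of V (x + y) \<le> s + t"
    if s: "0 < s" "sm (of_real (inverse s)) x \<in> V" and t: "0 < t" "sm (of_real (inverse t)) y \<in> V"
    for s t
  proof (rule gauge_of_le)
    \<comment> \<open>The vector (x + y) / (s + t) is the convex combination of x / s and y / t with
      weights s / (s + t) and t / (s + t).\<close>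
    have "sm (of_real (s / (s + t))) (sm (of_real (inverse s)) x)
        + sm (of_real (1 - s / (s + t))) (sm (of_real (inverse t)) y) \<in> V"
      using V(3)[unfolded convex_set_def, rule_format, OF s(2) t(2), of "s / (s + t)"] s(1) t(1)
      by (simp del: of_real_divide of_real_diff of_real_add of_real_inverse scale_scale)
    moreover have "s / (s + t) * inverse s = inverse (s + t)"
      "(1 - s / (s + t)) * inverse t = inverse (s + t)"
      using s(1) t(1) by (auto simp: field_simps add_pos_pos)
    ultimately show "sm (of_real (inverse (s + t))) (x + y) \<in> V"
      by (simp only: scale_scale of_real_mult[symmetric] scale_right_distrib)
  qed (use s t in simp)
  have "gauge_of V (x + y) - t \<le> gauge_of V x" if "0 < t" "sm (of_real (inverse t)) y \<in> V" for t
    using *[OF _ _ that] by (intro gauge_of_greatest) (simp add: algebra_simps)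
  then have "gauge_of V (x + y) - gauge_of V x \<le> gauge_of V y"
    by (intro gauge_of_greatest) (simp add: algebra_simps)
  then show "gauge_of V (x + y) \<le> gauge_of V x + gauge_of V y" by simp
next
  fix r :: real and x assume r: "r > 0"
  have "inverse r * gauge_of V (sm (of_real r) x) \<le> gauge_of V x"
  proof (rule gauge_of_greatest)
    fix t :: real assume t: "0 < t" "sm (of_real (inverse t)) x \<in> V"
    have "gauge_of V (sm (of_real r) x) \<le> r * t"
      using r t by (intro gauge_of_le) (simp_all add: field_simps)
    then show "inverse r * gauge_of V (sm (of_real r) x) \<le> t"
      using r by (simp add: field_simps)
  qed
  then show "gauge_of V (sm (of_real r) x) \<le> r * gauge_of V x"
    using r by (simp add: field_simps)
qed

theorem hahn_banach_separation:
  assumes v: "v \<notin> V"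
  obtains l where "functional l" "\<And>x. x \<in> V \<Longrightarrow> Re (l x) \<le> 1" "Re (l v) \<ge> 1"
proof -
  obtain l where l: "Vector_Spaces.linear sm (*) l" "\<And>x. Re (l x) \<le> gauge_of V x"
    "Re (l v) = gauge_of V v"
    using hahn_banach[OF sublinear_gauge_of] by blast
  have le1: "Re (l x) \<le> 1" if "x \<in> V" for x
    using l(2)[of x] gauge_of_le[of 1 x] that by simp
  have "1 \<le> gauge_of V v"
  proof (rule gauge_of_greatest)
    fix t :: real assume t: "0 < t" "sm (of_real (inverse t)) v \<in> V"
    show "1 \<le> t"
    proof (rule ccontr)
      assume "\<not> 1 \<le> t"
      then have "sm (of_real t) (sm (of_real (inverse t)) v) \<in> V"
        using t by (intro convex_shrink[OF t(2)]) auto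
      with t v show False by simp
    qed
  qed
  \<comment> \<open>On \<open>V\<close> only Re l is controlled, and only from above. Applying that
    bound to the four rotations of \<open>x\<close> bounds |Re (l x)| and |Im (l x)| by 1, which is
    enough for continuity.\<close>
  define W where "W = (\<Inter>c\<in>{1, -1, \<i>, -\<i>}. sm c -` V)"
  have "open W"
    unfolding W_def using V(1)
    by (intro open_INT ballI finite.intros)
      (auto intro!: open_vimage continuous_on_sm continuous_on_const continuous_on_id simp del: scale_minus_left)
  moreover have "0 \<in> W" using V by (simp add: W_def)
  moreover have "norm (l x) \<le> 2" if "x \<in> W" for x
  proof -
    have "Re (c * l x) \<le> 1" if "c \<in> {1, -1, \<i>, -\<i>}" for c
    proof -
      have "sm c x \<in> V" using \<open>x \<in> W\<close> that unfolding W_def by blast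
      with le1[of "sm c x"] l(1) show ?thesis by (simp add: Vector_Spaces.linear_iff)
    qed
    from this[of 1] this[of "-1"] this[of \<i>] this[of "-\<i>"]
    have "\<bar>Re (l x)\<bar> \<le> 1" "\<bar>Im (l x)\<bar> \<le> 1" by auto
    then show ?thesis using cmod_le[of "l x"] by linarith
  qed
  ultimately have "functional l" by (intro functional_bounded[OF l(1)]) auto
  then show ?thesis using le1 l(3) \<open>1 \<le> gauge_of V v\<close> by (intro that) auto
qed

end

text \<open>A form of the bipolar theorem. It converts estimates that are uniform over functionals
  bounded by 1 on \<open>W\<close> into smallness in the topology, and so replaces the
  seminorms.\<close>

lemma weak_nhd:
  assumes V: "open V" "(0::'a) \<in> V"
  obtains W where "open W" "0 \<in> W"
    "\<And>w. (\<And>l. functional l \<Longrightarrow> \<forall>x\<in>W. norm (l x) \<le> 1 \<Longrightarrow> norm (l w) < 1) \<Longrightarrow> w \<in> V"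
proof -
  obtain V' where V': "open V'" "0 \<in> V'" "V' \<subseteq> V" "convex_set V'" using convex_nhd[OF V] .
  \<comment> \<open>The factor 2 bounds the real and imaginary parts of a separating functional by 1
    / 2 on \<open>W\<close>, hence its modulus by 1.\<close>
  define W where "W = (\<Inter>c\<in>{2, -2, 2 * \<i>, - 2 * \<i>}. sm c -` V')"
  show ?thesis
  proof (rule that[of W])
    show "open W"
      unfolding W_def using V'(1)
      by (intro open_INT ballI finite.intros)
        (auto intro!: open_vimage continuous_on_sm continuous_on_const continuous_on_id simp del: scale_minus_left)
    show "0 \<in> W" using V' by (simp add: W_def)
    fix w assume w: "\<And>l. functional l \<Longrightarrow> \<forall>x\<in>W. norm (l x) \<le> 1 \<Longrightarrow> norm (l w) < 1"
    show "w \<in> V"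
    proof (rule ccontr)
      assume "w \<notin> V"
      then have "w \<notin> V'" using V' by auto
      then obtain l where l: "functional l" "\<And>x. x \<in> V' \<Longrightarrow> Re (l x) \<le> 1" "Re (l w) \<ge> 1"
        using hahn_banach_separation[OF V'(1,2,4)] by blast
      have "norm (l x) \<le> 1" if "x \<in> W" for x
      proof -
        have "Re (c * l x) \<le> 1" if "c \<in> {2, -2, 2 * \<i>, - 2 * \<i>}" for c
        proof -
          have "sm c x \<in> V'" using \<open>x \<in> W\<close> that unfolding W_def by blast
          with l(2)[of "sm c x"] show ?thesis by (simp add: functional_scale[OF l(1)])
        qed
        from this[of 2] this[of "-2"] this[of "2 * \<i>"] this[of "-2 * \<i>"]
        have "\<bar>Re (l x)\<bar> \<le> 1 / 2" "\<bar>Im (l x)\<bar> \<le> 1 / 2" by auto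
        then show ?thesis using cmod_le[of "l x"] by linarith
      qed
      with w[OF l(1)] have "norm (l w) < 1" by auto
      with l(3) complex_Re_le_cmod[of "l w"] show False by linarith
    qed
  qed
qed

text \<open>The set C + V, for a small convex \<open>V\<close>, is a convex open neighbourhood of 0
  that misses \<open>v\<close>. A functional whose real part is bounded above on the subspace
  \<open>C\<close> must vanish there.\<close>

lemma annihilator:
  assumes C: "closed C" "(0::'a) \<in> C" "\<And>x y. x \<in> C \<Longrightarrow> y \<in> C \<Longrightarrow> x + y \<in> C"
    "\<And>c x. x \<in> C \<Longrightarrow> sm c x \<in> C" and v: "v \<notin> C"
  obtains l where "functional l" "\<And>x. x \<in> C \<Longrightarrow> l x = 0" "l v \<noteq> 0"
proof -
  have "open ((\<lambda>x. v - x) -` (- C))"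
    using C(1) by (intro open_vimage continuous_on_diff' continuous_on_const continuous_on_id) auto
  moreover have "0 \<in> (\<lambda>x. v - x) -` (- C)" using v by simp
  ultimately obtain V where V: "open V" "0 \<in> V" "V \<subseteq> (\<lambda>x. v - x) -` (- C)" "convex_set V"
    by (rule convex_nhd)
  define V' where "V' = (\<Union>c\<in>C. (\<lambda>x. x - c) -` V)"
  have V'_iff: "x \<in> V' \<longleftrightarrow> (\<exists>c\<in>C. x - c \<in> V)" for x by (auto simp: V'_def)
  have "open V'"
    unfolding V'_def using V(1)
    by (intro open_UN ballI open_vimage continuous_on_diff' continuous_on_const continuous_on_id) auto
  moreover have V'0: "0 \<in> V'" using V C by (force simp: V'_iff)
  moreover have "convex_set V'"
    unfolding convex_set_def
  proof (intro ballI allI impI)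
    fix x y and t :: real assume xy: "x \<in> V'" "y \<in> V'" and t: "0 \<le> t \<and> t \<le> 1"
    then obtain c d where cd: "c \<in> C" "d \<in> C" "x - c \<in> V" "y - d \<in> V" by (auto simp: V'_iff)
    let ?e = "sm (of_real t) c + sm (of_real (1 - t)) d"
    have "sm (of_real t) (x - c) + sm (of_real (1 - t)) (y - d) \<in> V"
      using V(4) cd t unfolding convex_set_def by blast
    moreover have "sm (of_real t) (x - c) + sm (of_real (1 - t)) (y - d)
        = sm (of_real t) x + sm (of_real (1 - t)) y - ?e"
      by (simp add: scale_right_diff_distrib algebra_simps)
    moreover have "?e \<in> C" using C cd by blast
    ultimately show "sm (of_real t) x + sm (of_real (1 - t)) y \<in> V'"
      unfolding V'_iff by metis
  qed
  moreover have "v \<notin> V'"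
  proof
    assume "v \<in> V'"
    then obtain c where "c \<in> C" "v - c \<in> V" by (auto simp: V'_iff)
    with V(3) show False by auto
  qed
  ultimately obtain l where l: "functional l" "\<And>x. x \<in> V' \<Longrightarrow> Re (l x) \<le> 1" "Re (l v) \<ge> 1"
    using hahn_banach_separation by blast
  show ?thesis
  proof (rule that[OF l(1)])
    show "l v \<noteq> 0" using l(3) by auto
    fix x assume x: "x \<in> C"
    show "l x = 0"
    proof (rule ccontr)
      assume "l x \<noteq> 0"
      \<comment> \<open>This multiple of \<open>x\<close> lies in \<open>C\<close> and has value 2
        under \<open>l\<close>, which exceeds the bound 1.\<close>
      have "sm (2 / l x) x \<in> V'" using C(4)[OF x, of "2 / l x"] V(2) unfolding V'_iff by (intro bexI) auto
      from l(2)[OF this] \<open>l x \<noteq> 0\<close> show False by (simp add: functional_scale[OF l(1)])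
    qed
  qed
qed

lemma functional_separates:
  assumes "\<And>l. functional l \<Longrightarrow> l x = l (y :: 'a)"
  shows "x = y"
proof (rule ccontr)
  assume "x \<noteq> y"
  then have "x - y \<notin> {0}" by simp
  then obtain l where "functional l" "l (x - y) \<noteq> 0"
    using annihilator[of "{0}" "x - y"] by auto
  with assms show False by (simp add: functional_diff)
qed

end

section \<open>Weak integrals of continuous curves\<close>

text \<open>The error depends on \<open>f\<close> only through its oscillation \<open>e\<close> at
  the mesh size. The bound therefore holds simultaneously for all functions t \<mapsto> l (G t) with
  a common modulus of continuity.\<close>

lemma riemann_sum_bound:
  fixes f :: "real \<Rightarrow> complex"
  assumes f: "continuous_on {a..b} f" and "a < b" and "k > 0"
    and osc: "\<And>s t. s \<in> {a..b} \<Longrightarrow> t \<in> {a..b} \<Longrightarrow> \<bar>s - t\<bar> \<le> (b - a) / real k \<Longrightarrow> norm (f s - f t) \<le> e"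
  shows "norm ((\<Sum>j<k. of_real ((b - a) / real k) * f (a + real j * ((b - a) / real k)))
           - integral {a..b} f) \<le> (b - a) * e"
proof -
  define d where "d = (b - a) / real k"
  have d: "d > 0" "real k * d = b - a" using assms by (auto simp: d_def)
  have "norm ((\<Sum>j<n. of_real d * f (a + real j * d)) - integral {a..a + real n * d} f) \<le> real n * d * e"
    if "n \<le> k" for n
    using that
  proof (induction n)
    case (Suc n)
    define s where "s = a + real n * d"
    have le: "real (Suc n) * d \<le> real k * d" using Suc.prems d by (intro mult_right_mono) auto
    have s: "a \<le> s" "s + d \<le> b" "a + real (Suc n) * d = s + d"
      using le d by (auto simp: s_def algebra_simps)
    have cont: "continuous_on {s..s + d} f" "continuous_on {a..s + d} f"
      using s d by (auto intro!: continuous_on_subset[OF f])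
    have int: "f integrable_on {s..s + d}" "f integrable_on {a..s + d}"
      using cont by (auto intro: integrable_continuous_real)
    have "integral {s..s + d} (\<lambda>t. f s - f t) = of_real d * f s - integral {s..s + d} f"
      using int d by (subst integral_diff) (auto simp: scaleR_conv_of_real)
    moreover have "norm (integral {s..s + d} (\<lambda>t. f s - f t)) \<le> e * (s + d - s)"
      using s d by (intro integral_bound continuous_intros cont osc) (auto simp: d_def[symmetric])
    ultimately have 1: "norm (of_real d * f s - integral {s..s + d} f) \<le> d * e"
      by (simp add: mult.commute)
    have "integral {a..s} f + integral {s..s + d} f = integral {a..s + d} f"
      using s d int by (intro Henstock_Kurzweil_Integration.integral_combine) auto
    then have "(\<Sum>j<Suc n. of_real d * f (a + real j * d)) - integral {a..a + real (Suc n) * d} f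
        = ((\<Sum>j<n. of_real d * f (a + real j * d)) - integral {a..s} f)
          + (of_real d * f s - integral {s..s + d} f)"
      unfolding s(3) by (simp add: s_def algebra_simps)
    also have "norm \<dots> \<le> real n * d * e + d * e"
      using Suc by (intro norm_triangle_mono 1) (auto simp: s_def)
    finally show ?case by (simp add: algebra_simps)
  qed simp
  from this[of k] show ?thesis by (simp add: d(2) d_def[symmetric])
qed

context frechet
begin

text \<open>Uniform continuity of \<open>G\<close> gives one modulus of continuity for all
  functionals bounded by 1 on a neighbourhood \<open>W\<close>. The Riemann sums of \<open>G\<close>
  are thus Cauchy in the metric, and completeness supplies the integral.\<close>

lemma weak_integral_exists:
  fixes a b :: real
  assumes G: "continuous_on {a..b} G" and ab: "a < b"
  obtains v where "\<And>l. functional l \<Longrightarrow> l v = integral {a..b} (\<lambda>t. l (G t))"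
proof -
  define d where "d = (\<lambda>k. (b - a) / real (Suc k))"
  define R where "R = (\<lambda>k. \<Sum>j<Suc k. sm (of_real (d k)) (G (a + real j * d k)))"
  have close: "\<exists>k0. \<forall>k\<ge>k0. \<forall>l. functional l \<longrightarrow> (\<forall>x\<in>W. norm (l x) \<le> 1) \<longrightarrow>
      norm (l (R k) - integral {a..b} (\<lambda>t. l (G t))) \<le> (b - a) * e"
    if W: "open W" "0 \<in> W" and e: "e > 0" for W e
  proof -
    have "open (sm (of_real (1 / e)) -` W)"
      using W(1) by (intro open_vimage continuous_on_sm continuous_on_const continuous_on_id)
    moreover have "0 \<in> sm (of_real (1 / e)) -` W" using W by simp
    ultimately obtain r where r: "r > 0" "ball 0 r \<subseteq> sm (of_real (1 / e)) -` W"
      by (meson openE)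
    have "uniformly_continuous_on {a..b} G" by (intro compact_uniformly_continuous G) auto
    then obtain h where h: "h > 0"
      "\<And>s t. s \<in> {a..b} \<Longrightarrow> t \<in> {a..b} \<Longrightarrow> dist t s < h \<Longrightarrow> dist (G t) (G s) < r"
      using r(1) unfolding uniformly_continuous_on_def by metis
    obtain k0 where k0: "(b - a) / h < real k0" using reals_Archimedean2 by blast
    show ?thesis
    proof (intro exI[of _ k0] allI impI)
      fix k l assume k: "k0 \<le> k" and l: "functional l" "\<forall>x\<in>W. norm (l x) \<le> 1"
      have "(b - a) / h < real (Suc k)" using k k0 by simp
      then have dk: "d k < h" using h(1) by (simp add: d_def field_simps)
      have "continuous_on {a..b} (\<lambda>t. l (G t))"
        using l(1) G unfolding functional_def by (auto intro: continuous_on_compose2)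
      moreover have "norm (l (G s) - l (G t)) \<le> e"
        if "s \<in> {a..b}" "t \<in> {a..b}" "\<bar>s - t\<bar> \<le> (b - a) / real (Suc k)" for s t
      proof -
        have "dist (G s) (G t) < r"
          using that dk by (intro h(2)) (auto simp: d_def dist_real_def)
        then have "G s - G t \<in> ball 0 r" by (simp add: dist_commute[of 0] dist_diff_0)
        then have "norm (l (sm (of_real (1 / e)) (G s - G t))) \<le> 1" using r l(2) by blast
        then show ?thesis
          using e by (simp add: functional_scale[OF l(1)] functional_diff[OF l(1)] norm_divide field_simps)
      qed
      ultimately have "norm ((\<Sum>j<Suc k. of_real ((b - a) / real (Suc k)) * l (G (a + real j * ((b - a) / real (Suc k)))))
           - integral {a..b} (\<lambda>t. l (G t))) \<le> (b - a) * e"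
        using ab by (intro riemann_sum_bound) auto
      then show "norm (l (R k) - integral {a..b} (\<lambda>t. l (G t))) \<le> (b - a) * e"
        unfolding R_def functional_sum[OF l(1)] functional_scale[OF l(1)] d_def .
    qed
  qed
  have "Cauchy R"
  proof (rule metric_CauchyI)
    fix e :: real assume "e > 0"
    then obtain W where W: "open W" "0 \<in> W"
      "\<And>w. (\<And>l. functional l \<Longrightarrow> \<forall>x\<in>W. norm (l x) \<le> 1 \<Longrightarrow> norm (l w) < 1) \<Longrightarrow> w \<in> ball 0 e"
      using weak_nhd[of "ball 0 e"] by auto
    have *: "1 / (4 * (b - a)) > 0" "(b - a) * (1 / (4 * (b - a))) = 1 / 4" using ab by auto
    from close[OF W(1,2) *(1)] obtain k0 where k0:
      "\<And>k l. k \<ge> k0 \<Longrightarrow> functional l \<Longrightarrow> \<forall>x\<in>W. norm (l x) \<le> 1 \<Longrightarrow>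
        norm (l (R k) - integral {a..b} (\<lambda>t. l (G t))) \<le> 1 / 4"
      unfolding *(2) by blast
    show "\<exists>M. \<forall>m\<ge>M. \<forall>n\<ge>M. dist (R m) (R n) < e"
    proof (intro exI[of _ k0] allI impI)
      fix m n assume mn: "m \<ge> k0" "n \<ge> k0"
      have "R m - R n \<in> ball 0 e"
      proof (rule W(3))
        fix l assume l: "functional l" "\<forall>x\<in>W. norm (l x) \<le> 1"
        have "norm (l (R m) - l (R n)) \<le> 1 / 4 + 1 / 4"
          using norm_diff_triangle_le[OF k0[OF mn(1) l], of "l (R n)" "1 / 4"] k0[OF mn(2) l]
          by (simp add: norm_minus_commute)
        then show "norm (l (R m - R n)) < 1" by (simp add: functional_diff[OF l(1)])
      qed
      then show "dist (R m) (R n) < e" by (simp add: dist_commute[of 0] dist_diff_0)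
    qed
  qed
  then obtain v where v: "R \<longlonglongrightarrow> v" using Cauchy_convergent convergent_def by blast
  show ?thesis
  proof (rule that[of v])
    fix l assume l: "functional l"
    let ?I = "integral {a..b} (\<lambda>t. l (G t))"
    have "(\<lambda>k. l (R k)) \<longlonglongrightarrow> ?I"
    proof (rule LIMSEQ_I)
      fix e :: real assume e: "e > 0"
      \<comment> \<open>This neighbourhood is chosen for the single functional \<open>l\<close>, so
        that \<open>l\<close> itself is among the functionals bounded by 1 on it.\<close>
      have "open (l -` ball 0 1)"
        using l by (intro open_vimage) (auto simp: functional_def)
      moreover have "0 \<in> l -` ball 0 1" using functional_0[OF l] by simp
      moreover have *: "e / (2 * (b - a)) > 0" "(b - a) * (e / (2 * (b - a))) = e / 2"
        using e ab by (auto simp: field_simps)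
      ultimately obtain k0 where k0: "\<forall>k\<ge>k0. \<forall>l'. functional l' \<longrightarrow>
          (\<forall>x\<in>l -` ball 0 1. norm (l' x) \<le> 1) \<longrightarrow>
          norm (l' (R k) - integral {a..b} (\<lambda>t. l' (G t))) \<le> e / 2"
        using close[OF _ _ *(1), of "l -` ball 0 1"] unfolding *(2) by blast
      have "norm (l (R k) - ?I) \<le> e / 2" if "k \<ge> k0" for k
        using k0 that l by auto
      then show "\<exists>k0. \<forall>k\<ge>k0. norm (l (R k) - ?I) < e"
        using e by (intro exI[of _ k0]) force
    qed
    with functional_tendsto[OF l v] show "l v = ?I" by (rule LIMSEQ_unique)
  qed
qed

end

section \<open>Separated sets of positive lower density\<close>

text \<open>Consecutive positions \<open>j\<close> and \<open>j + 1\<close> are separated by more than their 2-adic valuations, yet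
  the positions grow linearly because the valuation is bounded on average.\<close>

definition ruler_sum :: "nat \<Rightarrow> nat" where
  "ruler_sum j = (\<Sum>i\<in>{1..j}. multiplicity 2 i + 1)"

text \<open>Blocks of radius \<open>multiplicity 2 i + 1\<close> are laid end to end and
  \<open>ruler_pos j\<close> is the centre of the \<open>j\<close>th one: twice the sum of the
  earlier radii plus the radius of block \<open>j\<close>. Two centres are then at least the sum of
  their radii apart.\<close>

definition ruler_pos :: "nat \<Rightarrow> nat" where
  "ruler_pos j = ruler_sum j + ruler_sum (j - 1)"

lemma ruler_sum_Suc: "ruler_sum (Suc j) = ruler_sum j + multiplicity 2 (Suc j) + 1"
  by (simp add: ruler_sum_def)

lemma ruler_sum_pred: "j > 0 \<Longrightarrow> ruler_sum j = ruler_sum (j - 1) + multiplicity 2 j + 1"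
  using ruler_sum_Suc[of "j - 1"] by simp

lemma ruler_sum_mono: "i \<le> j \<Longrightarrow> ruler_sum i \<le> ruler_sum j"
  unfolding ruler_sum_def by (intro sum_mono2) auto

text \<open>Up to 2 j there are j odd numbers, contributing 1 each, while an even number 2 i
  contributes one more than i does.\<close>

lemma ruler_sum_double: "ruler_sum (2 * j) = 2 * j + ruler_sum j"
proof (induction j)
  case (Suc j)
  have "multiplicity 2 (Suc (2 * j)) = 0" by (simp add: not_dvd_imp_multiplicity_0)
  moreover have "multiplicity 2 (2 * Suc j) = Suc (multiplicity 2 (Suc j))"
    by (rule multiplicity_times_same) auto
  ultimately show ?case
    using Suc ruler_sum_Suc[of "Suc (2 * j)"] ruler_sum_Suc[of "2 * j"] ruler_sum_Suc[of j] by simp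
qed (simp add: ruler_sum_def)

text \<open>Halving the argument and using the doubling formula shows that the radii have average at
  most 2. This linear growth is the source of positive density.\<close>

lemma ruler_sum_le: "ruler_sum j \<le> 2 * j"
proof (induction j rule: less_induct)
  case (less j)
  show ?case
  proof (cases "j = 0")
    case False
    define i where "i = j div 2"
    have i: "ruler_sum i \<le> 2 * i" using False by (intro less) (auto simp: i_def)
    consider "j = 2 * i" | "j = Suc (2 * i)" unfolding i_def by linarith
    then show ?thesis
    proof cases
      case 1
      then show ?thesis using i ruler_sum_double[of i] by simp
    next
      case 2
      have "multiplicity 2 (Suc (2 * i)) = 0" by (simp add: not_dvd_imp_multiplicity_0)
      then show ?thesis using i 2 ruler_sum_double[of i] ruler_sum_Suc[of "2 * i"] by simp
    qed
  qed (simp add: ruler_sum_def)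
qed

lemma ruler_pos_gap:
  assumes "0 < i" "i < j"
  shows "ruler_pos i + multiplicity 2 i + multiplicity 2 j < ruler_pos j"
proof -
  have "i \<le> j - 1" using assms by linarith
  from ruler_sum_mono[OF this] show ?thesis
    using ruler_sum_pred[of i] ruler_sum_pred[of j] assms by (simp add: ruler_pos_def)
qed

lemma separated_sets:
  obtains B :: "nat \<Rightarrow> nat set"
  where "\<And>k. lower_density (B k) > 0" "\<And>k n. n \<in> B k \<Longrightarrow> k \<le> n"
    "\<And>k k' m n. m \<in> B k \<Longrightarrow> n \<in> B k' \<Longrightarrow> m \<noteq> n \<Longrightarrow> int (max k k') \<le> \<bar>int m - int n\<bar>"
    "\<And>k k'. k \<noteq> k' \<Longrightarrow> B k \<inter> B k' = {}"
proof -
  define B where "B = (\<lambda>k. ruler_pos ` {j. 0 < j \<and> multiplicity 2 j = k})"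
  have gap: "ruler_pos i + max (multiplicity 2 i) (multiplicity 2 j) < ruler_pos j"
    if "0 < i" "i < j" for i j
    using ruler_pos_gap[OF that] by (simp add: max_def)
  have 1: "int (max k k') \<le> \<bar>int m - int n\<bar>"
    if mn: "m \<in> B k" "n \<in> B k'" "m \<noteq> n" for m n k k'
  proof -
    obtain i j where ij: "0 < i" "m = ruler_pos i" "multiplicity 2 i = k"
      "0 < j" "n = ruler_pos j" "multiplicity 2 j = k'" using mn(1,2) unfolding B_def by blast
    then consider "i < j" | "j < i" using \<open>m \<noteq> n\<close> by (metis linorder_neqE_nat)
    then show ?thesis
    proof cases
      case 1
      from gap[OF ij(1) this] show ?thesis unfolding ij(2,3,5,6) by linarith
    next
      case 2
      from gap[OF ij(4) this] show ?thesis unfolding ij(2,3,5,6) by linarith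
    qed
  qed
  have 2: "B k \<inter> B k' = {}"
    if "k \<noteq> k'" for k k'
  proof -
    have "ruler_pos i \<noteq> ruler_pos j" if "0 < i" "0 < j" "i \<noteq> j" for i j
      using gap[OF that(1), of j] gap[OF that(2), of i] that(3) by linarith
    then show ?thesis using \<open>k \<noteq> k'\<close> unfolding B_def by blast
  qed
  have 3: "k \<le> n" if n: "n \<in> B k" for k n
  proof -
    obtain j where "0 < j" "n = ruler_pos j" "multiplicity 2 j = k" using n unfolding B_def by blast
    then show ?thesis using ruler_sum_pred[of j] by (simp add: ruler_pos_def)
  qed
  have 4: "lower_density (B k) > 0" for k
  proof -
    have bound: "1 / (16 * 2 ^ k) \<le> real (card (B k \<inter> {1..n})) / real n" if n: "n \<ge> 16 * 2 ^ k" for n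
    proof -
      \<comment> \<open>The index 2^k (2 q + 1) has valuation \<open>k\<close> and position at most
        four times itself. For q < Q the position is at most 8 * 2^k * Q, hence at most
        \<open>n\<close>, so \<open>Q\<close> elements of \<open>B k\<close> are found up to
        \<open>n\<close>.\<close>
      define Q where "Q = n div (8 * 2 ^ k)"
      define g where "g = (\<lambda>q::nat. ruler_pos (2 ^ k * (2 * q + 1)))"
      have "g ` {..<Q} \<subseteq> B k \<inter> {1..n}"
      proof
        fix x assume "x \<in> g ` {..<Q}"
        then obtain q where q: "q < Q" "x = ruler_pos (2 ^ k * (2 * q + 1))" by (auto simp: g_def)
        let ?j = "2 ^ k * (2 * q + 1)"
        have mult: "multiplicity 2 ?j = k"
        proof (rule multiplicity_eqI)
          have "2 ^ k * 2 dvd ?j \<longleftrightarrow> 2 dvd 2 * q + 1" by (rule nat_mult_dvd_cancel1) simp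
          then show "\<not> 2 ^ Suc k dvd ?j" by (simp only: power_Suc2) simp
        qed simp
        have pos: "?j > 0" by simp
        have "x \<le> 4 * ?j"
          using q(2) ruler_sum_le[of ?j] ruler_sum_mono[of "?j - 1" ?j] by (simp add: ruler_pos_def)
        also have "\<dots> \<le> 4 * (2 ^ k * (2 * Q))" using q(1) by (intro mult_le_mono2) simp
        also have "\<dots> = Q * (8 * 2 ^ k)" by simp
        also have "\<dots> \<le> n" unfolding Q_def by (rule div_times_less_eq_dividend)
        finally have "x \<le> n" .
        moreover have "x \<ge> 1" using q(2) ruler_sum_pred[OF pos] by (simp add: ruler_pos_def)
        moreover have "x \<in> B k" using q(2) pos mult unfolding B_def by blast
        ultimately show "x \<in> B k \<inter> {1..n}" by simp
      qed
      moreover have "inj_on g {..<Q}"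
      proof (rule linorder_inj_onI)
        fix p q :: nat assume "p < q"
        then show "g p \<noteq> g q" unfolding g_def
          using gap[of "2 ^ k * (2 * p + 1)" "2 ^ k * (2 * q + 1)"] by simp
      qed auto
      ultimately have "Q \<le> card (B k \<inter> {1..n})"
        by (metis card_image card_lessThan card_mono finite_Int finite_atLeastAtMost)
      \<comment> \<open>Since Q \<ge> 1, the remainder of the division is at most 8 * 2^k * Q; this
        doubles the constant 8 to 16.\<close>
      moreover have "n \<le> 16 * 2 ^ k * Q"
      proof -
        have "n = Q * (8 * 2 ^ k) + n mod (8 * 2 ^ k)" unfolding Q_def by (rule div_mult_mod_eq[symmetric])
        moreover have "n mod (8 * 2 ^ k) < 8 * 2 ^ k" by simp
        moreover have "16 * 2 ^ k div (8 * 2 ^ k) \<le> Q" unfolding Q_def by (rule div_le_mono[OF n])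
        then have "1 * (8 * 2 ^ k) \<le> Q * (8 * 2 ^ k)" by (intro mult_le_mono1) simp
        moreover have "16 * 2 ^ k * Q = 2 * (Q * (8 * 2 ^ k))" by simp
        ultimately show ?thesis by linarith
      qed
      ultimately have "n \<le> 16 * 2 ^ k * card (B k \<inter> {1..n})"
        by (meson le_trans mult_le_mono2)
      then have "real n \<le> real (16 * 2 ^ k * card (B k \<inter> {1..n}))" by (rule of_nat_mono)
      moreover have "n > 0" using n by (rule less_le_trans[rotated]) simp
      ultimately show ?thesis by (simp add: field_simps)
    qed
    have "ereal (1 / (16 * 2 ^ k)) \<le> lower_density (B k)"
      unfolding lower_density_def
      by (intro Liminf_bounded eventually_sequentiallyI[of "16 * 2 ^ k"]) (use bound in simp)
    moreover have "0 < ereal (1 / (16 * 2 ^ k))" by simp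
    ultimately show ?thesis by (rule less_le_trans[rotated])
  qed
  show ?thesis by (rule that[OF 4 3 1 2])
qed

section \<open>A criterion for disjoint frequent hypercyclicity\<close>

lemma lower_density_mono:
  assumes "A \<subseteq> B"
  shows "lower_density A \<le> lower_density B"
  unfolding lower_density_def
proof (intro Liminf_mono always_eventually allI)
  fix n
  have "card (A \<inter> {1..n}) \<le> card (B \<inter> {1..n})" using assms by (intro card_mono) auto
  then show "ereal (real (card (A \<inter> {1..n})) / real n) \<le> ereal (real (card (B \<inter> {1..n})) / real n)"
    by (simp add: divide_right_mono)
qed

lemma sum_half_power_le: "finite L \<Longrightarrow> (\<Sum>l\<in>L. (1 / 2 :: real) ^ l) \<le> 2"
  using sum_le_suminf[OF summable_geometric[of "1/2::real"], of L] suminf_geometric[of "1/2::real"]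
  by simp

context frechet
begin

lemma cont_lin_op_pow:
  assumes "cont_lin_op sm T"
  shows "cont_lin_op sm (T ^^ m)"
proof (induction m)
  case 0
  then show ?case by (simp add: cont_lin_op_def Vector_Spaces.linear_iff vector_space_axioms id_def)
next
  case (Suc m)
  then show ?case using assms
    by (auto simp: cont_lin_op_def Vector_Spaces.linear_iff intro: continuous_on_compose2[of UNIV T])
qed

lemma cont_lin_op_add: "cont_lin_op sm T \<Longrightarrow> T (x + y) = T x + T y"
  and cont_lin_op_scale: "cont_lin_op sm T \<Longrightarrow> T (sm c x) = sm c (T x)"
  by (auto simp: cont_lin_op_def Vector_Spaces.linear_iff)

lemma cont_lin_op_0: "cont_lin_op sm T \<Longrightarrow> T 0 = 0"
  using cont_lin_op_scale[of T 0 0] by simp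

lemma cont_lin_op_sum: "cont_lin_op sm T \<Longrightarrow> T (\<Sum>i\<in>I. f i) = (\<Sum>i\<in>I. T (f i))"
  by (induction I rule: infinite_finite_induct) (simp_all add: cont_lin_op_add cont_lin_op_0)

lemma cont_lin_op_sum_list: "cont_lin_op sm T \<Longrightarrow> T (\<Sum>s\<leftarrow>xs. f s) = (\<Sum>s\<leftarrow>xs. T (f s))"
  by (induction xs) (simp_all add: cont_lin_op_add cont_lin_op_0)

lemma cont_lin_op_tendsto: "cont_lin_op sm T \<Longrightarrow> (f \<longlongrightarrow> x) F \<Longrightarrow> ((\<lambda>t. T (f t)) \<longlongrightarrow> T x) F"
  unfolding cont_lin_op_def by (metis UNIV_I continuous_on_eq_continuous_at isCont_tendsto_compose open_UNIV)

text \<open>The vector is the sum of \<open>u l n\<close> over all \<open>l\<close> and all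
  \<open>n\<close> in \<open>A l\<close>. Under \<open>T j ^^ m\<close> with \<open>m\<close> in
  \<open>A l\<close>, the term with index \<open>m\<close> lands near \<open>y l j\<close>, and all
  other indices are far from \<open>m\<close>. The disjunction in the smallness hypothesis has two
  uses: large \<open>n\<close> gives convergence of the series, large \<open>m\<close> gives the
  orbit estimate.\<close>

theorem separated_sum_vector:
  fixes u y :: "nat \<Rightarrow> nat \<Rightarrow> 'a"
  assumes J: "finite J" "J \<noteq> {}" and T: "\<And>j. j \<in> J \<Longrightarrow> cont_lin_op sm (T j)"
    and H1: "\<And>l j d. j \<in> J \<Longrightarrow> d > 0 \<Longrightarrow> \<exists>k. \<forall>m F. (\<forall>n\<in>F. int k \<le> \<bar>int n - int m\<bar>) \<and>
        (k \<le> m \<or> (\<forall>n\<in>F. k \<le> n)) \<longrightarrow> dist (\<Sum>n\<in>F. (T j ^^ m) (u l n)) 0 < d"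
    and H2: "\<And>l j d. j \<in> J \<Longrightarrow> d > 0 \<Longrightarrow> \<exists>k. \<forall>n\<ge>k. dist ((T j ^^ n) (u l n)) (y l j) < d"
  obtains x A where "\<And>l. lower_density (A l) > 0" "\<And>l n. n \<in> A l \<Longrightarrow> l \<le> n"
    "\<And>l n j. n \<in> A l \<Longrightarrow> j \<in> J \<Longrightarrow> dist ((T j ^^ n) x) (y l j) \<le> 3 * (1 / 2) ^ l"
proof -
  define good where "good = (\<lambda>a l j k.
      (\<forall>m F. (\<forall>n\<in>F. int k \<le> \<bar>int n - int m\<bar>) \<and> (k \<le> m \<or> (\<forall>n\<in>F. k \<le> n)) \<longrightarrow>
        dist (\<Sum>n\<in>F. (T j ^^ m) (u l n)) 0 < (1 / 4) ^ a) \<and>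
      (\<forall>n\<ge>k. dist ((T j ^^ n) (u l n)) (y l j) < (1 / 4) ^ a))"
  have ex: "\<exists>k. good a l j k" if j: "j \<in> J" for a l j
  proof -
    have pos: "(1 / 4 :: real) ^ a > 0" by simp
    obtain k1 where k1: "\<And>m F. (\<forall>n\<in>F. int k1 \<le> \<bar>int n - int m\<bar>) \<Longrightarrow> (k1 \<le> m \<or> (\<forall>n\<in>F. k1 \<le> n)) \<Longrightarrow>
        dist (\<Sum>n\<in>F. (T j ^^ m) (u l n)) 0 < (1 / 4) ^ a"
      using H1[OF j pos, of l] by blast
    obtain k2 where k2: "\<And>n. n \<ge> k2 \<Longrightarrow> dist ((T j ^^ n) (u l n)) (y l j) < (1 / 4) ^ a"
      using H2[OF j pos, of l] by blast
    show ?thesis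
      unfolding good_def
    proof (intro exI[of _ "k1 + k2"] conjI allI impI)
      fix m F assume *: "(\<forall>n\<in>F. int (k1 + k2) \<le> \<bar>int n - int m\<bar>) \<and> (k1 + k2 \<le> m \<or> (\<forall>n\<in>F. k1 + k2 \<le> n))"
      show "dist (\<Sum>n\<in>F. (T j ^^ m) (u l n)) 0 < (1 / 4) ^ a"
        by (rule k1) (use * in \<open>fastforce+\<close>)
    qed (use k2 in auto)
  qed
  define kk where "kk = (\<lambda>a l j. SOME k. good a l j k)"
  have good: "good a l j (kk a l j)" if "j \<in> J" for a l j
    unfolding kk_def by (rule someI_ex[OF ex[OF that]])
  have kk: "dist (\<Sum>n\<in>F. (T j ^^ m) (u l n)) 0 < (1 / 4) ^ a"
    if "j \<in> J" "\<forall>n\<in>F. int (kk a l j) \<le> \<bar>int n - int m\<bar>" "kk a l j \<le> m \<or> (\<forall>n\<in>F. kk a l j \<le> n)"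
    for a l j m F
    using good[OF that(1), of a l] that(2,3) unfolding good_def by blast
  have kk2: "dist ((T j ^^ n) (u l n)) (y l j) < (1 / 4) ^ a" if "j \<in> J" "n \<ge> kk a l j" for a l j n
    using good[OF that(1), of a l] that(2) unfolding good_def by blast
  \<comment> \<open>A common threshold for accuracy level \<open>a\<close>, dominating those of all
    targets b \<le> a and all operators. The \<open>Suc\<close> makes it strictly increasing, so
    that the sets \<open>B (K l)\<close> are disjoint for distinct \<open>l\<close>.\<close>
  define K where "K = (\<lambda>a::nat. \<Sum>a'\<le>a. Suc (\<Sum>b\<le>a'. \<Sum>j\<in>J. kk a' b j))"
  have K_mono: "strict_mono K" unfolding K_def by (rule strict_monoI_Suc) simp
  have K_le: "kk a b j \<le> K a" if "b \<le> a" "j \<in> J" for a b j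
  proof -
    have "kk a b j \<le> (\<Sum>j\<in>J. kk a b j)" using that J by (intro member_le_sum) auto
    also have "\<dots> \<le> (\<Sum>b\<le>a. \<Sum>j\<in>J. kk a b j)" using that by (intro member_le_sum) auto
    also have "\<dots> \<le> Suc \<dots>" by simp
    also have "\<dots> \<le> K a" unfolding K_def by (intro member_le_sum) auto
    finally show ?thesis .
  qed
  have K1: "dist (\<Sum>n\<in>F. (T j ^^ m) (u l n)) 0 < (1 / 4) ^ a"
    if "l \<le> a" "j \<in> J" "\<forall>n\<in>F. int (K a) \<le> \<bar>int n - int m\<bar>" "K a \<le> m \<or> (\<forall>n\<in>F. K a \<le> n)" for l a j m F
    using K_le[OF that(1,2)] that by (intro kk) (force intro: order_trans)+
  have K2: "dist ((T j ^^ n) (u l n)) (y l j) < (1 / 4) ^ l" if "j \<in> J" "n \<ge> K l" for l j n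
    using K_le[OF order_refl that(1)] that by (intro kk2) (auto intro: order_trans)
  obtain B where B: "\<And>k. lower_density (B k) > 0" "\<And>k n. n \<in> B k \<Longrightarrow> k \<le> n"
    "\<And>k k' m n. m \<in> B k \<Longrightarrow> n \<in> B k' \<Longrightarrow> m \<noteq> n \<Longrightarrow> int (max k k') \<le> \<bar>int m - int n\<bar>"
    "\<And>k k'. k \<noteq> k' \<Longrightarrow> B k \<inter> B k' = {}" by (rule separated_sets) blast
  define A where "A = (\<lambda>l. B (K l))"
  have K_inj: "K l = K l' \<longleftrightarrow> l = l'" for l l' using K_mono by (simp add: strict_mono_eq)
  have K_max: "K (max a b) = max (K a) (K b)" for a b
    using strict_mono_mono[OF K_mono] by (simp add: mono_def max_def) (metis le_antisym nat_le_linear)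
  have K_ge: "l \<le> K l" for l by (rule strict_mono_imp_increasing[OF K_mono])
  define \<Lambda> where "\<Lambda> = (\<lambda>n. THE l. n \<in> A l)"
  have \<Lambda>: "\<Lambda> n = l" if "n \<in> A l" for n l
    unfolding \<Lambda>_def
  proof (rule the_equality)
    show "n \<in> A l" by (rule that)
    fix l' assume "n \<in> A l'"
    then show "l' = l" using that B(4)[of "K l'" "K l"] by (auto simp: A_def K_inj)
  qed
  define U where "U = (\<lambda>n. u (\<Lambda> n) n)"
  define D where "D = (\<Union>l. A l)"
  have D: "n \<in> A (\<Lambda> n)" if "n \<in> D" for n using that \<Lambda> by (auto simp: D_def)
  \<comment> \<open>The sum is grouped by the target \<open>l\<close> served. Block \<open>l\<close>
    has accuracy level max l p, and (1/4)^(max l p) \<le> (1/2)^p (1/2)^l: one factor is the error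
    wanted, the other is summable over \<open>l\<close> with total at most 2.\<close>
  have main: "dist (\<Sum>n\<in>F. (T j ^^ m) (U n)) 0 \<le> 2 * (1 / 2) ^ p"
    if F: "finite F" "F \<subseteq> D" and j: "j \<in> J" and sep: "\<forall>n\<in>F. int (K (max (\<Lambda> n) p)) \<le> \<bar>int n - int m\<bar>"
      and or: "K p \<le> m \<or> (\<forall>n\<in>F. K p \<le> n)" for F j m p
  proof -
    have block: "dist (\<Sum>n\<in>{n\<in>F. \<Lambda> n = l}. (T j ^^ m) (U n)) 0 \<le> (1 / 2) ^ p * (1 / 2) ^ l" for l
    proof -
      let ?a = "max l p"
      have eq: "(\<Sum>n\<in>{n\<in>F. \<Lambda> n = l}. (T j ^^ m) (U n)) = (\<Sum>n\<in>{n\<in>F. \<Lambda> n = l}. (T j ^^ m) (u l n))"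
        by (rule sum.cong) (auto simp: U_def)
      have "dist (\<Sum>n\<in>{n\<in>F. \<Lambda> n = l}. (T j ^^ m) (u l n)) 0 < (1 / 4) ^ ?a"
      proof (rule K1[OF _ j])
        show "\<forall>n\<in>{n \<in> F. \<Lambda> n = l}. int (K ?a) \<le> \<bar>int n - int m\<bar>" using sep by auto
        \<comment> \<open>For l \<le> p the level is \<open>p\<close> and the assumption
          \<open>or\<close> suffices. For l > p the second alternative holds automatically, because
          all elements of \<open>A l\<close> are at least \<open>K l\<close>.\<close>
        have "K l \<le> n" if "n \<in> F" "\<Lambda> n = l" for n
          using D[of n] that F B(2)[of n "K l"] by (auto simp: A_def)
        then show "K ?a \<le> m \<or> (\<forall>n\<in>{n \<in> F. \<Lambda> n = l}. K ?a \<le> n)"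
          using or by (cases "l \<le> p") (auto simp: max_def)
      qed simp
      moreover have "(1 / 4 :: real) ^ ?a \<le> (1 / 2) ^ p * (1 / 2) ^ l"
      proof -
        have "(1 / 4 :: real) ^ ?a = (1 / 2) ^ ?a * (1 / 2) ^ ?a"
          by (simp add: power_mult_distrib[symmetric])
        also have "\<dots> \<le> (1 / 2) ^ p * (1 / 2) ^ l"
          by (intro mult_mono power_decreasing) auto
        finally show ?thesis .
      qed
      ultimately show ?thesis unfolding eq by linarith
    qed
    have "(\<Sum>n\<in>F. (T j ^^ m) (U n)) = (\<Sum>l\<in>\<Lambda> ` F. \<Sum>n\<in>{n\<in>F. \<Lambda> n = l}. (T j ^^ m) (U n))"
      by (rule sum.image_gen[OF F(1)])
    also have "dist \<dots> 0 \<le> (\<Sum>l\<in>\<Lambda> ` F. (1 / 2) ^ p * (1 / 2) ^ l)"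
      by (intro order_trans[OF dist_sum_0_le] sum_mono block)
    also have "\<dots> = (1 / 2) ^ p * (\<Sum>l\<in>\<Lambda> ` F. (1 / 2) ^ l)" by (simp add: sum_distrib_left)
    also have "\<dots> \<le> (1 / 2) ^ p * 2" using F by (intro mult_left_mono sum_half_power_le) auto
    finally show ?thesis by (simp add: mult.commute)
  qed
  define S where "S = (\<lambda>L. \<Sum>n\<in>{..<L} \<inter> D. U n)"
  obtain j0 where j0: "j0 \<in> J" using J by blast
  have S_diff: "dist (S M) (S L) \<le> 2 * (1 / 2) ^ p" if "K p \<le> L" "L \<le> M" for L M p
  proof -
    have "{..<M} \<inter> D = ({..<L} \<inter> D) \<union> ({L..<M} \<inter> D)" using that by auto
    then have "S M - S L = (\<Sum>n\<in>{L..<M} \<inter> D. U n)"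
      unfolding S_def by (simp add: sum.union_disjoint Int_assoc disjoint_iff)
    \<comment> \<open>Convergence of the series is the case of power 0. The distance of
      \<open>n\<close> from 0 is \<open>n\<close> itself, which is at least
      \<open>K (\<Lambda> n)\<close> and at least \<open>K p\<close>.\<close>
    moreover have "dist (\<Sum>n\<in>{L..<M} \<inter> D. (T j0 ^^ 0) (U n)) 0 \<le> 2 * (1 / 2) ^ p"
    proof (rule main)
      show "\<forall>n\<in>{L..<M} \<inter> D. int (K (max (\<Lambda> n) p)) \<le> \<bar>int n - int 0\<bar>"
        using D B(2) that by (fastforce simp: K_max A_def)
    qed (use that j0 in auto)
    ultimately show ?thesis using dist_diff_0[of "S M" "S L"] by simp
  qed
  have "Cauchy S"
  proof (rule CauchyI')
    fix e :: real assume "e > 0"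
    then obtain p where p: "(1 / 2) ^ p < e / 2" using real_arch_pow_inv[of "e / 2" "1 / 2"] by auto
    show "\<exists>M. \<forall>m\<ge>M. \<forall>n>m. dist (S m) (S n) < e"
    proof (intro exI[of _ "K p"] allI impI)
      fix m n assume "m \<ge> K p" "n > m"
      then have "dist (S n) (S m) \<le> 2 * (1 / 2) ^ p" by (intro S_diff) auto
      then show "dist (S m) (S n) < e" using p by (simp add: dist_commute)
    qed
  qed
  then obtain x where x: "S \<longlonglongrightarrow> x" using Cauchy_convergent convergent_def by blast
  show ?thesis
  proof (rule that[of A x])
    show "lower_density (A l) > 0" for l using B(1) by (simp add: A_def)
    show "l \<le> n" if "n \<in> A l" for l n
      using B(2)[of n "K l"] K_ge[of l] that by (simp add: A_def)
    fix l m j assume m: "m \<in> A l" and j: "j \<in> J"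
    note Tm = cont_lin_op_pow[OF T[OF j], of m]
    have Kl: "K l \<le> m" using B(2)[of m "K l"] m by (simp add: A_def)
    \<comment> \<open>Of the constant 3, one part is the error of the term with index
      \<open>m\<close>, two parts come from all the other terms.\<close>
    have est: "dist ((T j ^^ m) (S L)) (y l j) \<le> 3 * (1 / 2) ^ l" if L: "L > m" for L
    proof -
      let ?F = "{..<L} \<inter> D - {m}"
      have mD: "m \<in> {..<L} \<inter> D" using L m by (auto simp: D_def)
      have "(T j ^^ m) (S L) = (T j ^^ m) (U m) + (\<Sum>n\<in>?F. (T j ^^ m) (U n))"
        unfolding S_def cont_lin_op_sum[OF Tm] by (rule sum.remove[OF _ mD]) simp
      also have "U m = u l m" by (simp add: U_def \<Lambda>[OF m])
      finally have "(T j ^^ m) (S L) - y l j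
          = ((T j ^^ m) (u l m) - y l j) + (\<Sum>n\<in>?F. (T j ^^ m) (U n))" by simp
      then have "dist ((T j ^^ m) (S L)) (y l j)
          \<le> dist ((T j ^^ m) (u l m)) (y l j) + dist (\<Sum>n\<in>?F. (T j ^^ m) (U n)) 0"
        by (metis dist_add_0_le dist_diff_0)
      moreover have "dist ((T j ^^ m) (u l m)) (y l j) < (1 / 4) ^ l" by (rule K2[OF j Kl])
      moreover have "(1 / 4 :: real) ^ l \<le> (1 / 2) ^ l" by (rule power_mono) auto
      moreover have "dist (\<Sum>n\<in>?F. (T j ^^ m) (U n)) 0 \<le> 2 * (1 / 2) ^ l"
      proof (rule main[OF _ _ j])
        show "\<forall>n\<in>?F. int (K (max (\<Lambda> n) l)) \<le> \<bar>int n - int m\<bar>"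
        proof
          fix n assume "n \<in> ?F"
          then have "n \<in> B (K (\<Lambda> n))" "n \<noteq> m" using D by (auto simp: A_def)
          then show "int (K (max (\<Lambda> n) l)) \<le> \<bar>int n - int m\<bar>"
            using B(3)[of n "K (\<Lambda> n)" m "K l"] m unfolding K_max by (simp add: A_def)
        qed
      qed (use Kl in auto)
      ultimately show ?thesis by linarith
    qed
    have "(\<lambda>L. dist ((T j ^^ m) (S L)) (y l j)) \<longlonglongrightarrow> dist ((T j ^^ m) x) (y l j)"
      by (intro tendsto_dist cont_lin_op_tendsto[OF Tm] x tendsto_const)
    then show "dist ((T j ^^ m) x) (y l j) \<le> 3 * (1 / 2) ^ l"
      by (rule LIMSEQ_le_const2) (use est in \<open>auto intro!: exI[of _ "Suc m"]\<close>)
  qed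
qed

end

text \<open>Convergence of \<open>w\<close> to 0 along the sets of all \<open>p\<close> with
  \<open>R k p\<close>, as \<open>k\<close> grows. With pairs of a power and an index set as
  \<open>p\<close>, it lets the uniform estimates be added like limits.\<close>

definition small :: "(nat \<Rightarrow> 'p \<Rightarrow> bool) \<Rightarrow> ('p \<Rightarrow> 'a::{zero,metric_space}) \<Rightarrow> bool" where
  "small R w \<longleftrightarrow> (\<forall>d>0. \<exists>k. \<forall>p. R k p \<longrightarrow> dist (w p) 0 < d)"

text \<open>The vectors \<open>e s n\<close> play the role of \<open>S\<^sup>n (e s 0)\<close> for a right inverse \<open>S\<close> of \<open>T i\<close>; the sums
  over all finite \<open>F\<close> encode unconditional convergence, uniformly in the exponent \<open>m\<close>.\<close>

definition adapted_family ::
    "'i set \<Rightarrow> ('i \<Rightarrow> 'a \<Rightarrow> 'a) \<Rightarrow> 'i \<Rightarrow> (nat \<Rightarrow> nat \<Rightarrow> 'a::{ab_group_add,metric_space}) \<Rightarrow> bool" where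
  "adapted_family J T i e \<longleftrightarrow>
     closure (range (\<lambda>xs. \<Sum>s\<leftarrow>xs. e s 0)) = UNIV \<and>
     (\<forall>s n. (T i ^^ n) (e s n) = e s 0) \<and>
     (\<forall>s d. d > 0 \<longrightarrow> (\<exists>k. \<forall>m F. (\<forall>n\<in>F. int k \<le> \<bar>int n - int m\<bar>) \<longrightarrow>
        dist (\<Sum>n\<in>F. (T i ^^ m) (e s n)) 0 < d)) \<and>
     (\<forall>j\<in>J. j \<noteq> i \<longrightarrow> (\<forall>s d. d > 0 \<longrightarrow> (\<exists>k. \<forall>m F. (k \<le> m \<or> (\<forall>n\<in>F. k \<le> n)) \<longrightarrow>
        dist (\<Sum>n\<in>F. (T j ^^ m) (e s n)) 0 < d)))"

lemma openin_product_euclidean_box: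
  assumes "openin (product_topology (\<lambda>_. euclidean) I) W" "w \<in> W"
  obtains G where "\<And>i. i \<in> I \<Longrightarrow> open (G i)" "w \<in> Pi\<^sub>E I G" "Pi\<^sub>E I G \<subseteq> W"
proof -
  from bspec[OF iffD1[OF openin_product_topology_alt assms(1)] assms(2)]
  obtain G where "\<forall>i\<in>I. openin euclidean (G i)" "w \<in> Pi\<^sub>E I G" "Pi\<^sub>E I G \<subseteq> W"
    by (elim exE conjE)
  then show ?thesis by (intro that) auto
qed

context frechet
begin

context
  fixes R :: "nat \<Rightarrow> 'p \<Rightarrow> bool"
  assumes anti: "\<And>k k' p. k \<le> k' \<Longrightarrow> R k' p \<Longrightarrow> R k p"
begin

lemma small_0: "small R (\<lambda>_. 0 :: 'a)"
  by (simp add: small_def)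

lemma small_add:
  fixes v w :: "'p \<Rightarrow> 'a"
  assumes "small R v" "small R w"
  shows "small R (\<lambda>p. v p + w p)"
  unfolding small_def
proof (intro allI impI)
  fix d :: real assume "d > 0"
  then have d: "d / 2 > 0" by simp
  obtain k1 where k1: "\<And>p. R k1 p \<Longrightarrow> dist (v p) 0 < d / 2"
    using assms(1) d unfolding small_def by blast
  obtain k2 where k2: "\<And>p. R k2 p \<Longrightarrow> dist (w p) 0 < d / 2"
    using assms(2) d unfolding small_def by blast
  have "dist (v p + w p) 0 < d" if "R (max k1 k2) p" for p
    using dist_add_0_le[of "v p" "w p"] k1[of p] k2[of p] anti[OF _ that, of k1] anti[OF _ that, of k2]
    by simp
  then show "\<exists>k. \<forall>p. R k p \<longrightarrow> dist (v p + w p) 0 < d" by blast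
qed

lemma small_sum:
  fixes f :: "'i \<Rightarrow> 'p \<Rightarrow> 'a"
  shows "(\<And>i. i \<in> I \<Longrightarrow> small R (f i)) \<Longrightarrow> small R (\<lambda>p. \<Sum>i\<in>I. f i p)"
  by (induction I rule: infinite_finite_induct) (simp_all add: small_add small_0)

lemma small_sum_list:
  fixes f :: "'s \<Rightarrow> 'p \<Rightarrow> 'a"
  shows "(\<And>s. small R (f s)) \<Longrightarrow> small R (\<lambda>p. \<Sum>s\<leftarrow>xs. f s p)"
  by (induction xs) (simp_all add: small_add small_0)

end

lemma sum_sum_list_swap:
  fixes f :: "'n \<Rightarrow> 's \<Rightarrow> 'a"
  shows "(\<Sum>n\<in>F. \<Sum>s\<leftarrow>xs. f n s) = (\<Sum>s\<leftarrow>xs. \<Sum>n\<in>F. f n s)"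
  by (induction xs) (simp_all add: sum.distrib)

lemma diff_sum_list:
  fixes f g :: "'s \<Rightarrow> 'a"
  shows "(\<Sum>s\<leftarrow>xs. f s) - (\<Sum>s\<leftarrow>xs. g s) = (\<Sum>s\<leftarrow>xs. f s - g s)"
  by (induction xs) (simp_all add: algebra_simps)

text \<open>To reach a tuple of targets at time \<open>n\<close>, one backward orbit for each
  operator is added. Under \<open>T j ^^ n\<close> the summand built for \<open>T j\<close> returns
  its target exactly, while the summands built for the other operators fade.\<close>

theorem disjoint_frequent_hypercyclicity_criterion:
  fixes T :: "nat \<Rightarrow> 'a \<Rightarrow> 'a" and e :: "nat \<Rightarrow> nat \<Rightarrow> nat \<Rightarrow> 'a"
  assumes N: "N \<ge> 1" and T: "\<And>i. i \<in> {1..N} \<Longrightarrow> cont_lin_op sm (T i)"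
    and adapted: "\<And>i. i \<in> {1..N} \<Longrightarrow> adapted_family {1..N} T i (e i)"
  shows "densely_d_freq_hypercyclic N T"
proof -
  have dense: "closure (range (\<lambda>xs. \<Sum>s\<leftarrow>xs. e i s 0)) = UNIV" if "i \<in> {1..N}" for i
    using adapted[OF that] unfolding adapted_family_def by blast
  have inverse: "(T i ^^ n) (e i s n) = e i s 0" if "i \<in> {1..N}" for i s n
    using adapted[OF that] unfolding adapted_family_def by blast
  have diag: "\<exists>k. \<forall>m F. (\<forall>n\<in>F. int k \<le> \<bar>int n - int m\<bar>) \<longrightarrow>
      dist (\<Sum>n\<in>F. (T i ^^ m) (e i s n)) 0 < d" if "i \<in> {1..N}" "d > 0" for i s d
    using adapted[OF that(1)] that(2) unfolding adapted_family_def by blast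
  have off_diag: "\<exists>k. \<forall>m F. (k \<le> m \<or> (\<forall>n\<in>F. k \<le> n)) \<longrightarrow>
      dist (\<Sum>n\<in>F. (T j ^^ m) (e i s n)) 0 < d"
    if "i \<in> {1..N}" "j \<in> {1..N}" "i \<noteq> j" "d > 0" for i j s d
    using adapted[OF that(1)] that(2-4) unfolding adapted_family_def by (elim conjE) simp
  \<comment> \<open>Discarding the first component makes every tuple of lists occur for infinitely
    many \<open>l\<close>, hence with arbitrarily small errors (1/2)^l. For tuples shorter than
    \<open>N\<close>, \<open>nth\<close> may return an unspecified list; the estimates hold for any
    lists.\<close>
  define ls where "ls = (\<lambda>l. snd (from_nat l :: nat \<times> nat list list))"
  define u where "u = (\<lambda>l n. \<Sum>i\<in>{1..N}. \<Sum>s\<leftarrow>ls l ! (i - 1). e i s n)"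
  define y where "y = (\<lambda>l j. \<Sum>s\<leftarrow>ls l ! (j - 1). e j s 0)"
  have T_u: "(T j ^^ m) (u l n) = (\<Sum>i\<in>{1..N}. \<Sum>s\<leftarrow>ls l ! (i - 1). (T j ^^ m) (e i s n))"
    if "j \<in> {1..N}" for j m l n
    unfolding u_def cont_lin_op_sum[OF cont_lin_op_pow[OF T[OF that]]]
      cont_lin_op_sum_list[OF cont_lin_op_pow[OF T[OF that]]] ..
  have H1: "\<exists>k. \<forall>m F. (\<forall>n\<in>F. int k \<le> \<bar>int n - int m\<bar>) \<and> (k \<le> m \<or> (\<forall>n\<in>F. k \<le> n)) \<longrightarrow>
      dist (\<Sum>n\<in>F. (T j ^^ m) (u l n)) 0 < d" if j: "j \<in> {1..N}" and d: "d > 0" for l j d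
  proof -
    define R where "R = (\<lambda>k p. (\<forall>n\<in>snd p. int k \<le> \<bar>int n - int (fst p)\<bar>) \<and>
      (k \<le> fst p \<or> (\<forall>n\<in>snd p. k \<le> n)))"
    have anti: "R k p" if "k \<le> k'" "R k' p" for k k' p
      using that unfolding R_def by (meson order_trans of_nat_mono)
    have "small R (\<lambda>p. \<Sum>n\<in>snd p. (T j ^^ fst p) (e i s n))" if i: "i \<in> {1..N}" for i s
      unfolding small_def
    proof (intro allI impI)
      fix d' :: real assume d': "d' > 0"
      show "\<exists>k. \<forall>p. R k p \<longrightarrow> dist (\<Sum>n\<in>snd p. (T j ^^ fst p) (e i s n)) 0 < d'"
      proof (cases "i = j")
        case True
        from diag[OF i d', of s] show ?thesis unfolding True R_def by blast
      next
        case False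
        from off_diag[OF i j False d', of s] show ?thesis unfolding R_def by blast
      qed
    qed
    then have "small R (\<lambda>p. \<Sum>i\<in>{1..N}. \<Sum>s\<leftarrow>ls l ! (i - 1). \<Sum>n\<in>snd p. (T j ^^ fst p) (e i s n))"
      by (intro small_sum[OF anti] small_sum_list[OF anti])
    then have "small R (\<lambda>p. \<Sum>n\<in>snd p. (T j ^^ fst p) (u l n))"
      unfolding T_u[OF j] sum_sum_list_swap[symmetric] by (subst sum.swap)
    then have "\<exists>k. \<forall>p. R k p \<longrightarrow> dist (\<Sum>n\<in>snd p. (T j ^^ fst p) (u l n)) 0 < d"
      using d unfolding small_def by blast
    then show ?thesis unfolding R_def by (metis fst_conv snd_conv)
  qed
  have H2: "\<exists>k. \<forall>n\<ge>k. dist ((T j ^^ n) (u l n)) (y l j) < d" if j: "j \<in> {1..N}" and d: "d > 0" for l j d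
  proof -
    let ?R = "\<lambda>k n :: nat. k \<le> n"
    \<comment> \<open>For i = j the difference is identically 0; for other \<open>i\<close> the
      off-diagonal condition is used with the singleton {n}.\<close>
    have "small ?R (\<lambda>n. (T j ^^ n) (e i s n) - (if i = j then e j s 0 else 0))" if i: "i \<in> {1..N}" for i s
    proof (cases "i = j")
      case True
      then show ?thesis using inverse[OF j] by (simp add: small_0)
    next
      case False
      have "\<exists>k. \<forall>n\<ge>k. dist ((T j ^^ n) (e i s n)) 0 < d'" if "d' > 0" for d'
      proof -
        obtain k where k: "\<And>m F. k \<le> m \<or> (\<forall>n\<in>F. k \<le> n) \<Longrightarrow> dist (\<Sum>n\<in>F. (T j ^^ m) (e i s n)) 0 < d'"
          using off_diag[OF i j False \<open>d' > 0\<close>] by blast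
        have "dist ((T j ^^ n) (e i s n)) 0 < d'" if "k \<le> n" for n
          using k[of n "{n}"] that by simp
        then show ?thesis by blast
      qed
      then show ?thesis using False by (simp add: small_def)
    qed
    then have "small ?R (\<lambda>n. \<Sum>i\<in>{1..N}. \<Sum>s\<leftarrow>ls l ! (i - 1). (T j ^^ n) (e i s n) - (if i = j then e j s 0 else 0))"
      by (intro small_sum small_sum_list) auto
    moreover have "(\<Sum>i\<in>{1..N}. \<Sum>s\<leftarrow>ls l ! (i - 1). (T j ^^ n) (e i s n) - (if i = j then e j s 0 else 0))
        = (T j ^^ n) (u l n) - y l j" for n
    proof -
      have "(\<Sum>i\<in>{1..N}. \<Sum>s\<leftarrow>ls l ! (i - 1). if i = j then e j s 0 else 0)
          = (\<Sum>i\<in>{1..N}. if i = j then y l j else 0)"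
        by (intro sum.cong) (auto simp: y_def)
      also have "\<dots> = y l j" using j by simp
      finally show ?thesis
        unfolding T_u[OF j] by (simp only: diff_sum_list[symmetric] sum_subtractf)
    qed
    ultimately show ?thesis using d by (simp add: small_def dist_diff_0)
  qed
  have J: "finite {1..N}" "{1..N} \<noteq> {}" using N by auto
  obtain x A where xA: "\<And>l. lower_density (A l) > 0" "\<And>l n. n \<in> A l \<Longrightarrow> l \<le> n"
    "\<And>l n j. n \<in> A l \<Longrightarrow> j \<in> {1..N} \<Longrightarrow> dist ((T j ^^ n) x) (y l j) \<le> 3 * (1 / 2) ^ l"
    by (rule separated_sum_vector[where u = u and y = y, OF J T H1 H2]) blast+
  have vec: "d_freq_hypercyclic_vec N T (x + (\<Sum>s\<leftarrow>xs. e 1 s 0))" for xs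
    unfolding d_freq_hypercyclic_vec_def
  proof (intro allI impI, elim conjE)
    define z where "z = (\<Sum>s\<leftarrow>xs. e 1 s 0)"
    have z: "\<exists>k. \<forall>n\<ge>k. dist ((T j ^^ n) z) 0 < d" if j: "j \<in> {1..N}" and d: "d > 0" for j d
    proof -
      have "\<exists>k. \<forall>n\<ge>k. dist ((T j ^^ n) (e 1 s 0)) 0 < d'" if "d' > 0" for d' s
      proof -
        \<comment> \<open>The decay of a forward orbit is the case F = {0} of the two smallness
          conditions: a power m \<ge> k is at distance at least \<open>k\<close> from 0.\<close>
        have "\<exists>k. \<forall>m\<ge>k. dist (\<Sum>n\<in>{0}. (T j ^^ m) (e 1 s n)) 0 < d'"
        proof (cases "j = 1")
          case True
          obtain k where k: "\<And>m F. \<forall>n\<in>F. int k \<le> \<bar>int n - int m\<bar> \<Longrightarrow> dist (\<Sum>n\<in>F. (T j ^^ m) (e j s n)) 0 < d'"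
            using diag[OF j \<open>d' > 0\<close>] by blast
          have "dist (\<Sum>n\<in>{0}. (T j ^^ m) (e j s n)) 0 < d'" if "m \<ge> k" for m
            by (rule k) (use that in simp)
          then show ?thesis using True by blast
        next
          case False
          have "1 \<in> {1..N}" "1 \<noteq> j" using N False by auto
          then obtain k where k: "\<And>m F. k \<le> m \<or> (\<forall>n\<in>F. k \<le> n) \<Longrightarrow>
              dist (\<Sum>n\<in>F. (T j ^^ m) (e 1 s n)) 0 < d'"
            using off_diag[OF _ j _ \<open>d' > 0\<close>] by blast
          then show ?thesis by blast
        qed
        then show ?thesis by simp
      qed
      then have "small (\<le>) (\<lambda>n. \<Sum>s\<leftarrow>xs. (T j ^^ n) (e 1 s 0))"
        by (intro small_sum_list) (auto simp: small_def)
      then show ?thesis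
        using d by (simp add: small_def z_def cont_lin_op_sum_list[OF cont_lin_op_pow[OF T[OF j]]])
    qed
    fix W :: "(nat \<Rightarrow> 'a) set"
    assume W: "openin (product_topology (\<lambda>_. euclidean) {1..N}) W" and "W \<noteq> {}"
    then obtain w where w: "w \<in> W" by blast
    obtain G where G: "\<And>i. i \<in> {1..N} \<Longrightarrow> open (G i)" "w \<in> Pi\<^sub>E {1..N} G" "Pi\<^sub>E {1..N} G \<subseteq> W"
      by (rule openin_product_euclidean_box[OF W w]) blast
    have "\<exists>r>0. ball (w i) r \<subseteq> G i" if "i \<in> {1..N}" for i
      using G(1)[OF that] PiE_mem[OF G(2) that] unfolding open_contains_ball by blast
    then obtain r where r: "\<And>i. i \<in> {1..N} \<Longrightarrow> r i > 0" "\<And>i. i \<in> {1..N} \<Longrightarrow> ball (w i) (r i) \<subseteq> G i"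
      by metis
    \<comment> \<open>Three errors have to fit: the orbit of \<open>x\<close> against the coded
      target, the coded target against \<open>w\<close>, and the perturbation caused by
      \<open>z\<close>.\<close>
    define d where "d = Min (r ` {1..N}) / 3"
    have d: "d > 0" using r(1) N by (auto simp: d_def)
    have d_le: "3 * d \<le> r i" if "i \<in> {1..N}" for i using that by (simp add: d_def)
    have "\<exists>ys. dist (\<Sum>s\<leftarrow>ys. e i s 0) (w i) < d" if "i \<in> {1..N}" for i
    proof -
      have "w i \<in> closure (range (\<lambda>xs. \<Sum>s\<leftarrow>xs. e i s 0))" using dense[OF that] by simp
      then show ?thesis using d unfolding closure_approachable by blast
    qed
    then obtain ys where ys: "\<And>i. i \<in> {1..N} \<Longrightarrow> dist (\<Sum>s\<leftarrow>ys i. e i s 0) (w i) < d" by metis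
    define code where "code = map (\<lambda>i. ys (Suc i)) [0..<N]"
    have code: "code ! (i - 1) = ys i" if "i \<in> {1..N}" for i
    proof -
      have "i - 1 < N" "Suc (i - 1) = i" using that by auto
      then show ?thesis by (simp add: code_def)
    qed
    have "\<exists>k. \<forall>n\<ge>k. dist ((T j ^^ n) z) 0 < d" if "j \<in> {1..N}" for j using z[OF that d] .
    then obtain k where k: "\<And>j n. j \<in> {1..N} \<Longrightarrow> n \<ge> k j \<Longrightarrow> dist ((T j ^^ n) z) 0 < d" by metis
    obtain p where p: "(1 / 2) ^ p < d / 3" using real_arch_pow_inv[of "d / 3" "1 / 2"] d by auto
    \<comment> \<open>A code of the chosen tuple exists beyond \<open>p\<close> and beyond all
      \<open>k j\<close>. As elements of \<open>A l\<close> are at least \<open>l\<close>, one such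
      \<open>l\<close> controls both the approximation error and the orbit of
      \<open>z\<close>.\<close>
    have "infinite (range (\<lambda>c::nat. to_nat (c, code)))"
      by (rule range_inj_infinite) (auto simp: inj_def)
    then obtain l where l: "l \<ge> p + Max (k ` {1..N})" "l \<in> range (\<lambda>c::nat. to_nat (c, code))"
      unfolding infinite_nat_iff_unbounded_le by blast
    have ls: "ls l = code" using l(2) by (auto simp: ls_def)
    have kl: "k j \<le> l" if "j \<in> {1..N}" for j
    proof -
      have "k j \<le> Max (k ` {1..N})" using that by (intro Max_ge) auto
      then show ?thesis using l(1) by simp
    qed
    have "A l \<subseteq> {n. restrict (\<lambda>i. (T i ^^ n) (x + z)) {1..N} \<in> W}"
    proof
      fix n assume n: "n \<in> A l"
      have "(T i ^^ n) (x + z) \<in> G i" if i: "i \<in> {1..N}" for i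
      proof -
        have "(1 / 2 :: real) ^ l \<le> (1 / 2) ^ p" using l(1) by (intro power_decreasing) auto
        then have "dist ((T i ^^ n) x) (y l i) < d" using xA(3)[OF n i] p by linarith
        moreover have "dist (y l i) (w i) < d" using ys[OF i] unfolding y_def ls code[OF i] .
        moreover have "dist ((T i ^^ n) (x + z)) ((T i ^^ n) x) < d"
        proof -
          have "dist ((T i ^^ n) z) 0 < d" using kl[OF i] xA(2)[OF n] by (intro k i) simp
          then show ?thesis
            using dist_add_left[of "(T i ^^ n) x" "(T i ^^ n) z" 0]
            by (simp add: cont_lin_op_add[OF cont_lin_op_pow[OF T[OF i]]])
        qed
        ultimately have "dist ((T i ^^ n) (x + z)) (w i) < d + d + d"
          using dist_triangle[of "(T i ^^ n) (x + z)" "w i" "(T i ^^ n) x"]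
            dist_triangle[of "(T i ^^ n) x" "w i" "y l i"] by linarith
        then have "(T i ^^ n) (x + z) \<in> ball (w i) (r i)" using d_le[OF i] by (simp add: dist_commute)
        then show ?thesis using r(2)[OF i] by blast
      qed
      then have "restrict (\<lambda>i. (T i ^^ n) (x + z)) {1..N} \<in> Pi\<^sub>E {1..N} G" by auto
      then show "n \<in> {n. restrict (\<lambda>i. (T i ^^ n) (x + z)) {1..N} \<in> W}" using G(3) by blast
    qed
    from less_le_trans[OF xA(1) lower_density_mono[OF this]]
    show "0 < lower_density {n. restrict (\<lambda>i. (T i ^^ n) (x + (\<Sum>s\<leftarrow>xs. e 1 s 0))) {1..N} \<in> W}"
      by (simp only: z_def)
  qed
  show ?thesis
    unfolding densely_d_freq_hypercyclic_def
  proof (intro set_eqI iffI UNIV_I)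
    fix x0 :: 'a
    show "x0 \<in> closure {x. d_freq_hypercyclic_vec N T x}"
      unfolding closure_approachable
    proof (intro allI impI)
      fix d :: real assume "d > 0"
      moreover have "x0 - x \<in> closure (range (\<lambda>xs. \<Sum>s\<leftarrow>xs. e 1 s 0))" using dense[of 1] N by simp
      ultimately obtain xs where "dist (\<Sum>s\<leftarrow>xs. e 1 s 0) (x0 - x) < d"
        unfolding closure_approachable by blast
      then have "dist (x + (\<Sum>s\<leftarrow>xs. e 1 s 0)) x0 < d"
        using dist_add_left[of x "\<Sum>s\<leftarrow>xs. e 1 s 0" "x0 - x"] by simp
      then show "\<exists>v\<in>{x. d_freq_hypercyclic_vec N T x}. dist v x0 < d" using vec by blast
    qed
  qed
qed

end

section \<open>Local charts and oscillatory integrals\<close>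

text \<open>The map \<open>\<gamma>\<close> is a local inverse of \<open>\<phi> i\<close> after z
  \<mapsto> exp (i z), so real \<open>z\<close> correspond to unimodular values. The radius 2 \<rho>
  leaves room for a compact disc of radius \<rho>, and \<rho> \<le> 1 keeps nearby angles less than
  2 pi apart.\<close>

lemma unimodular_chart:
  fixes \<phi> :: "'i \<Rightarrow> complex \<Rightarrow> complex"
  assumes Om: "open Om" "connected Om" and J: "finite J" "i \<in> J"
    and hol: "\<And>j. j \<in> J \<Longrightarrow> \<phi> j holomorphic_on Om"
    and nc: "\<not> \<phi> i constant_on Om"
    and z0: "z0 \<in> Om" "norm (\<phi> i z0) = 1" "\<And>j. j \<in> J \<Longrightarrow> j \<noteq> i \<Longrightarrow> norm (\<phi> j z0) < 1"
  obtains \<gamma> :: "complex \<Rightarrow> complex" and \<theta> \<rho> r :: real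
  where "0 < \<rho>" "\<rho> \<le> 1" "0 \<le> r" "r < 1" "\<gamma> holomorphic_on (ball (of_real \<theta>) (2 * \<rho>))"
    "\<And>z. z \<in> ball (of_real \<theta>) (2 * \<rho>) \<Longrightarrow> \<gamma> z \<in> Om"
    "\<And>z. z \<in> ball (of_real \<theta>) (2 * \<rho>) \<Longrightarrow> \<phi> i (\<gamma> z) = exp (\<i> * z)"
    "\<And>z j. z \<in> ball (of_real \<theta>) (2 * \<rho>) \<Longrightarrow> j \<in> J \<Longrightarrow> j \<noteq> i \<Longrightarrow> norm (\<phi> j (\<gamma> z)) \<le> r"
proof -
  define V where "V = (\<lambda>r. Om \<inter> (\<Inter>j\<in>J - {i}. {z \<in> Om. norm (\<phi> j z) < r}))"
  have V_open: "open (V r)" for r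
  proof -
    have "open {z \<in> Om. norm (\<phi> j z) < r}" if "j \<in> J" for j
    proof -
      have "continuous_on Om (\<lambda>z. norm (\<phi> j z))"
        using hol[OF that] by (intro continuous_intros holomorphic_on_imp_continuous_on)
      from continuous_open_preimage[OF this Om(1), of "{..<r}"]
      show ?thesis by (simp add: vimage_def Int_def)
    qed
    then show ?thesis unfolding V_def using J Om by (intro open_Int open_INT) auto
  qed
  have "\<forall>\<^sub>F w in at z0. deriv (\<phi> i) w \<noteq> 0 \<and> w \<in> Om"
  proof -
    have "\<exists>b\<in>Om. deriv (\<phi> i) b \<noteq> 0"
    proof (rule ccontr)
      assume "\<not> (\<exists>b\<in>Om. deriv (\<phi> i) b \<noteq> 0)"
      then have "(\<phi> i has_field_derivative 0) (at z)" if "z \<in> Om" for z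
        using holomorphic_derivI[OF hol[OF J(2)] Om(1) that] that by simp
      then have "\<phi> i constant_on Om"
        using Om has_field_derivative_0_imp_constant_on[of Om "\<phi> i"] by blast
      with nc show False by simp
    qed
    then obtain b where "b \<in> Om" "deriv (\<phi> i) b \<noteq> 0" by blast
    then show ?thesis
      using hol[OF J(2)] Om z0(1) by (intro non_zero_neighbour_alt[of _ _ _ b] holomorphic_deriv) auto
  qed
  then obtain e1 where e1: "e1 > 0" "\<And>w. w \<noteq> z0 \<Longrightarrow> dist w z0 < e1 \<Longrightarrow> deriv (\<phi> i) w \<noteq> 0"
    by (auto simp: eventually_at)
  have "z0 \<in> V 1" using z0 by (auto simp: V_def)
  then obtain e2 where e2: "e2 > 0" "ball z0 e2 \<subseteq> V 1" using V_open openE by blast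
  define e where "e = min e1 e2"
  have e: "e > 0" "ball z0 e \<subseteq> V 1" using e1 e2 by (auto simp: e_def)
  \<comment> \<open>The critical points of \<open>\<phi> i\<close> are isolated and \<open>\<phi> i\<close> is open, so moving along the unit circle in
    the image leads to a nearby non-critical point \<open>z1\<close> with the same properties as \<open>z0\<close>.\<close>
  have "open (\<phi> i ` ball z0 e)"
    using e by (intro open_mapping_thm[OF hol[OF J(2)] Om _ _ nc]) (auto simp: V_def)
  moreover have "continuous_on UNIV (\<lambda>t::real. \<phi> i z0 * exp (\<i> * of_real t))"
    by (intro continuous_intros)
  ultimately have "open ((\<lambda>t::real. \<phi> i z0 * exp (\<i> * of_real t)) -` (\<phi> i ` ball z0 e))"
    by (intro open_vimage)
  moreover have "0 \<in> (\<lambda>t::real. \<phi> i z0 * exp (\<i> * of_real t)) -` (\<phi> i ` ball z0 e)"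
    using e by simp
  ultimately obtain h where h: "h > 0"
    "ball 0 h \<subseteq> (\<lambda>t::real. \<phi> i z0 * exp (\<i> * of_real t)) -` (\<phi> i ` ball z0 e)"
    by (meson openE)
  \<comment> \<open>A rotation by a positive angle below 2 pi is not trivial, so the point reached
    differs from \<open>z0\<close>.\<close>
  define t where "t = min (h / 2) 1"
  have t: "0 < t" "t \<le> 1" "t \<in> ball 0 h" using h(1) by (auto simp: t_def)
  then obtain z1 where z1: "z1 \<in> ball z0 e" "\<phi> i z1 = \<phi> i z0 * exp (\<i> * of_real t)"
    using subsetD[OF h(2) t(3)] by auto
  have norm1: "norm (\<phi> i z1) = 1" using z0(2) by (simp add: z1(2) norm_mult)
  have "z1 \<noteq> z0"
  proof
    assume "z1 = z0"
    moreover have "\<phi> i z0 \<noteq> 0" using z0(2) by auto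
    ultimately have "exp (\<i> * of_real t) = exp 0" using z1(2) by simp
    moreover have "\<bar>Im (\<i> * of_real t) - Im 0\<bar> < 2 * pi" using t pi_gt3 by simp
    ultimately have "\<i> * of_real t = (0 :: complex)" by (metis exp_complex_eqI)
    with t(1) show False by simp
  qed
  moreover have "dist z1 z0 < e1"
    using z1(1) unfolding e_def mem_ball by (subst dist_commute) linarith
  ultimately have d1: "deriv (\<phi> i) z1 \<noteq> 0" by (rule e1(2))
  have z1V: "z1 \<in> V 1" using subsetD[OF e(2) z1(1)] .
  \<comment> \<open>Inserting 0 keeps the maximum meaningful when \<open>J\<close> contains only
    \<open>i\<close>, and makes the later \<open>r\<close> nonnegative.\<close>
  define m where "m = Max (insert 0 ((\<lambda>j. norm (\<phi> j z1)) ` (J - {i})))"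
  have "m < 1" unfolding m_def using J z1V by (subst Max_less_iff) (auto simp: V_def)
  then obtain r where r: "m < r" "r < 1" using dense by blast
  have m_ge: "x \<le> m" if "x \<in> insert 0 ((\<lambda>j. norm (\<phi> j z1)) ` (J - {i}))" for x
    unfolding m_def using J that by (intro Max_ge) auto
  have "0 \<le> m" by (rule m_ge) simp
  have "norm (\<phi> j z1) < r" if "j \<in> J - {i}" for j
    using m_ge[of "norm (\<phi> j z1)"] that r(1) by auto
  then have "z1 \<in> V r" using z1V by (auto simp: V_def)
  moreover have hol_V: "\<phi> i holomorphic_on V r"
    by (rule holomorphic_on_subset[OF hol[OF J(2)]]) (auto simp: V_def)
  ultimately obtain s where s: "s > 0" "ball z1 s \<subseteq> V r" "open (\<phi> i ` ball z1 s)" "inj_on (\<phi> i) (ball z1 s)"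
    using has_complex_derivative_locally_invertible[OF hol_V _ V_open d1] by blast
  obtain g where g: "g holomorphic_on (\<phi> i ` ball z1 s)" "\<And>z. z \<in> ball z1 s \<Longrightarrow> g (\<phi> i z) = z"
    by (rule holomorphic_has_inverse[OF holomorphic_on_subset[OF hol_V s(2)] open_ball s(4)]) blast
  define \<theta> where "\<theta> = Arg (\<phi> i z1)"
  have \<theta>: "exp (\<i> * of_real \<theta>) = \<phi> i z1"
  proof -
    have "\<phi> i z1 \<noteq> 0" using norm1 by auto
    from Arg_eq[OF this, symmetric] show ?thesis unfolding norm1 \<theta>_def by simp
  qed
  have "continuous_on UNIV (\<lambda>z::complex. exp (\<i> * z))" by (intro continuous_intros)
  then have "open ((\<lambda>z. exp (\<i> * z)) -` (\<phi> i ` ball z1 s))" using s(3) by (intro open_vimage)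
  moreover have "of_real \<theta> \<in> (\<lambda>z. exp (\<i> * z)) -` (\<phi> i ` ball z1 s)" using s(1) \<theta> by auto
  ultimately obtain R where R: "R > 0" "ball (of_real \<theta>) R \<subseteq> (\<lambda>z. exp (\<i> * z)) -` (\<phi> i ` ball z1 s)"
    by (meson openE)
  define \<rho> where "\<rho> = min (R / 2) 1"
  have sub: "exp (\<i> * z) \<in> \<phi> i ` ball z1 s" if "z \<in> ball (of_real \<theta>) (2 * \<rho>)" for z
    using R(2) that by (force simp: \<rho>_def)
  have \<gamma>: "g (exp (\<i> * z)) \<in> ball z1 s" "\<phi> i (g (exp (\<i> * z))) = exp (\<i> * z)"
    if "z \<in> ball (of_real \<theta>) (2 * \<rho>)" for z
    using sub[OF that] g(2) by auto
  show ?thesis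
  proof (rule that[of \<rho> r "\<lambda>z. g (exp (\<i> * z))" \<theta>])
    have "g \<circ> (\<lambda>z. exp (\<i> * z)) holomorphic_on (ball (of_real \<theta>) (2 * \<rho>))"
      by (rule holomorphic_on_compose_gen[OF _ g(1)]) (intro holomorphic_intros image_subsetI sub)+
    then show "(\<lambda>z. g (exp (\<i> * z))) holomorphic_on (ball (of_real \<theta>) (2 * \<rho>))"
      by (simp add: o_def)
    show "g (exp (\<i> * z)) \<in> Om" if "z \<in> ball (of_real \<theta>) (2 * \<rho>)" for z
      using subsetD[OF s(2) \<gamma>(1)[OF that]] by (simp add: V_def)
    show "norm (\<phi> j (g (exp (\<i> * z)))) \<le> r" if "z \<in> ball (of_real \<theta>) (2 * \<rho>)" "j \<in> J" "j \<noteq> i" for z j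
      using subsetD[OF s(2) \<gamma>(1)[OF that(1)]] that(2,3) by (simp add: V_def less_imp_le)
    show "\<phi> i (g (exp (\<i> * z))) = exp (\<i> * z)" if "z \<in> ball (of_real \<theta>) (2 * \<rho>)" for z
      by (rule \<gamma>(2)[OF that])
  qed (use R(1) r \<open>0 \<le> m\<close> in \<open>simp_all add: \<rho>_def\<close>)
qed

text \<open>The double zeros at the end points remove the boundary terms of two integrations by parts.\<close>

definition bump :: "real \<Rightarrow> real \<Rightarrow> complex \<Rightarrow> complex" where
  "bump a b z = (z - of_real a)\<^sup>2 * (z - of_real b)\<^sup>2"

text \<open>The constant depends only on the interval and the disc. Cauchy's inequality bounds the
  second derivative of the amplitude by \<open>M\<close>, so a sup bound for \<open>h\<close> is all
  that is needed, whichever functional \<open>h\<close> comes from.\<close>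

lemma oscillatory_decay:
  fixes a b \<theta> \<rho> :: real
  assumes \<rho>: "\<rho> > 0" and ab: "\<theta> - \<rho> / 2 \<le> a" "a < b" "b \<le> \<theta> + \<rho> / 2"
  obtains C where "C \<ge> 0"
    "\<And>h M n. h holomorphic_on (ball (of_real \<theta>) \<rho>) \<Longrightarrow> (\<And>z. z \<in> ball (of_real \<theta>) \<rho> \<Longrightarrow> norm (h z) \<le> M) \<Longrightarrow>
      norm (integral {a..b} (\<lambda>t. exp (\<i> * of_int n * of_real t) * bump a b (of_real t) * h (of_real t)))
        \<le> C * M / (1 + (real_of_int n)\<^sup>2)"
proof -
  define A where "A = (2 * \<rho>) ^ 4"
  define D where "D = 32 * A / \<rho>\<^sup>2 * (b - a)"
  have "A \<ge> 0" using \<rho> by (simp add: A_def)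
  then have "D \<ge> 0" using \<rho> ab by (simp add: D_def)
  show ?thesis
  \<comment> \<open>The number \<open>A\<close> bounds the bump, whose four linear factors are at
    most 2 \<rho>. The 32 in \<open>D\<close> is 2! * 4^2, from Cauchy's inequality on discs of
    radius \<rho> / 4. The summand \<open>A * (b - a)\<close> serves n = 0; the factor 2 replaces 1
    / n^2 by 1 / (1 + n^2).\<close>
  proof (rule that[of "2 * D + A * (b - a)"])
    show "2 * D + A * (b - a) \<ge> 0" using \<open>A \<ge> 0\<close> \<open>D \<ge> 0\<close> ab by simp
    fix h :: "complex \<Rightarrow> complex" and M n
    let ?B = "ball (of_real \<theta> :: complex) \<rho>"
    assume h: "h holomorphic_on ?B" and M: "\<And>z. z \<in> ?B \<Longrightarrow> norm (h z) \<le> M"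
    have "norm (h (of_real \<theta>)) \<le> M" using \<rho> by (intro M) simp
    then have "M \<ge> 0" by (meson norm_ge_zero order_trans)
    define F where "F = (\<lambda>z. bump a b z * h z)"
    have F_hol: "F holomorphic_on ?B"
      unfolding F_def bump_def by (intro holomorphic_intros h)
    have F_le: "norm (F z) \<le> A * M" if "z \<in> ?B" for z
    proof -
      have *: "norm (z - of_real c) \<le> 2 * \<rho>" if c: "\<bar>c - \<theta>\<bar> \<le> \<rho> / 2" for c
      proof -
        have "norm (z - of_real c) \<le> norm (z - of_real \<theta>) + norm (of_real \<theta> - of_real c :: complex)"
          using norm_triangle_ineq[of "z - of_real \<theta>" "of_real \<theta> - of_real c"] by simp
        also have "norm (of_real \<theta> - of_real c :: complex) = \<bar>\<theta> - c\<bar>" by (metis norm_of_real of_real_diff)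
        finally have "norm (z - of_real c) \<le> norm (z - of_real \<theta>) + \<bar>\<theta> - c\<bar>" .
        moreover have "norm (z - of_real \<theta>) < \<rho>"
          using \<open>z \<in> ?B\<close> by (simp add: dist_norm norm_minus_commute)
        ultimately show ?thesis using c \<rho> by linarith
      qed
      have "norm (bump a b z) \<le> (2 * \<rho>)\<^sup>2 * (2 * \<rho>)\<^sup>2"
        unfolding bump_def norm_mult norm_power
        using ab \<rho> by (intro mult_mono power_mono * norm_ge_zero zero_le_power) linarith+
      also have "\<dots> = A" by (simp add: A_def power2_eq_square power4_eq_xxxx)
      finally show ?thesis
        unfolding F_def norm_mult using M[OF that] \<open>A \<ge> 0\<close> by (intro mult_mono) auto
    qed
    have inB: "of_real t \<in> ?B" if "t \<in> {a..b}" for t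
    proof -
      have "dist (of_real \<theta> :: complex) (of_real t) = \<bar>\<theta> - t\<bar>" by (metis dist_of_real dist_real_def)
      then show ?thesis using that ab \<rho> by auto
    qed
    define ex where "ex = (\<lambda>z. exp (\<i> * of_int n * z))"
    have ex1: "norm (ex (of_real t)) = 1" for t :: real
    proof -
      have "\<i> * of_int n * of_real t = \<i> * of_real (of_int n * t)" by simp
      then show ?thesis unfolding ex_def by (metis norm_exp_i_times)
    qed
    define F1 where "F1 = deriv F"
    define F2 where "F2 = deriv F1"
    have F1_hol: "F1 holomorphic_on ?B" unfolding F1_def by (intro holomorphic_deriv F_hol) simp
    have F2_hol: "F2 holomorphic_on ?B" unfolding F2_def by (intro holomorphic_deriv F1_hol) simp
    have F2_le: "norm (F2 (of_real t)) \<le> 32 * A * M / \<rho>\<^sup>2" if t: "t \<in> {a..b}" for t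
    proof -
      \<comment> \<open>The interval stays within \<rho> / 2 of the centre, so these discs stay
        within 3 \<rho> / 4.\<close>
      have sub: "cball (of_real t) (\<rho> / 4) \<subseteq> ?B"
      proof
        fix z :: complex assume z: "z \<in> cball (of_real t) (\<rho> / 4)"
        have "dist (of_real \<theta> :: complex) (of_real t) = \<bar>\<theta> - t\<bar>" by (metis dist_of_real dist_real_def)
        then have "dist (of_real \<theta>) z \<le> \<rho> / 2 + \<rho> / 4"
          using dist_triangle[of "of_real \<theta>" z "of_real t"] z t ab by auto
        then show "z \<in> ?B" using \<rho> by simp
      qed
      have "norm ((deriv ^^ 2) F (of_real t)) \<le> fact 2 * (A * M) / (\<rho> / 4) ^ 2"
      proof (rule Cauchy_inequality)
        show "F holomorphic_on (ball (of_real t) (\<rho> / 4))"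
          by (rule holomorphic_on_subset[OF F_hol]) (use sub in \<open>auto simp: subset_iff\<close>)
        show "continuous_on (cball (of_real t) (\<rho> / 4)) F"
          by (rule continuous_on_subset[OF holomorphic_on_imp_continuous_on[OF F_hol] sub])
        show "norm (F x) \<le> A * M" if "norm (of_real t - x) = \<rho> / 4" for x
          using sub that by (intro F_le) (auto simp: dist_norm subset_iff)
      qed (use \<rho> in simp)
      also have "(deriv ^^ 2) F = F2" by (simp add: F2_def F1_def numeral_2_eq_2)
      also have "fact 2 * (A * M) / (\<rho> / 4) ^ 2 = 32 * A * M / \<rho>\<^sup>2"
        using \<rho> by (simp add: power2_eq_square field_simps)
      finally show ?thesis .
    qed
    have cont: "continuous_on {a..b} (\<lambda>t. ex (of_real t) * f (of_real t))" if "f holomorphic_on ?B" for f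
      unfolding ex_def
      by (intro continuous_intros continuous_on_compose2[OF holomorphic_on_imp_continuous_on[OF that]])
        (use inB in auto)
    define I where "I = integral {a..b} (\<lambda>t. ex (of_real t) * F (of_real t))"
    have I_eq: "I = integral {a..b} (\<lambda>t. exp (\<i> * of_int n * of_real t) * bump a b (of_real t) * h (of_real t))"
      by (simp add: I_def ex_def F_def mult.assoc)
    have "norm I \<le> (2 * D + A * (b - a)) * M / (1 + (real_of_int n)\<^sup>2)"
    proof (cases "n = 0")
      case True
      have "norm I \<le> A * M * (b - a)"
        unfolding I_def using ab cont[OF F_hol] F_le inB ex1
        by (intro integral_bound) (auto simp: norm_mult)
      also have "\<dots> \<le> (2 * D + A * (b - a)) * M"
        using \<open>D \<ge> 0\<close> \<open>M \<ge> 0\<close> by (simp add: algebra_simps)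
      finally show ?thesis using True by simp
    next
      case False
      define c where "c = (\<i> * of_int n :: complex)"
      have c: "c \<noteq> 0" using False by (simp add: c_def)
      \<comment> \<open>a primitive of \<open>ex * F - ex * F2 / c\<^sup>2\<close> vanishing at both end points\<close>
      define P where "P = (\<lambda>z. ex z * (F z / c - F1 z / c\<^sup>2))"
      have F_der: "(F has_field_derivative F1 z) (at z)" if "z \<in> ?B" for z
        unfolding F1_def by (rule holomorphic_derivI[OF F_hol open_ball that])
      have F1_der: "(F1 has_field_derivative F2 z) (at z)" if "z \<in> ?B" for z
        unfolding F2_def by (rule holomorphic_derivI[OF F1_hol open_ball that])
      have P_der: "(P has_field_derivative ex z * F z - ex z * F2 z / c\<^sup>2) (at z)" if "z \<in> ?B" for z
      proof -
        have "(ex has_field_derivative c * ex z) (at z)"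
          unfolding ex_def c_def[symmetric] by (auto intro!: derivative_eq_intros)
        then show ?thesis
          unfolding P_def using c
          by (auto intro!: derivative_eq_intros F_der[OF that] F1_der[OF that] simp: field_simps power2_eq_square)
      qed
      have "((\<lambda>t. ex (of_real t) * F (of_real t) - ex (of_real t) * F2 (of_real t) / c\<^sup>2)
          has_integral (P (of_real b) - P (of_real a))) {a..b}"
      proof (rule fundamental_theorem_of_calculus)
        show "((\<lambda>t. P (of_real t)) has_vector_derivative
            ex (of_real t) * F (of_real t) - ex (of_real t) * F2 (of_real t) / c\<^sup>2) (at t within {a..b})"
          if "t \<in> {a..b}" for t
          using has_vector_derivative_real_field[OF P_der[OF inB[OF that]]]
          by (rule has_vector_derivative_at_within)
      qed (use ab in simp)
      moreover have "P (of_real b) = 0" "P (of_real a) = 0"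
      proof -
        have "F1 (of_real a) = 0" "F1 (of_real b) = 0"
        proof -
          have der: "(h has_field_derivative deriv h z) (at z)" if "z \<in> ?B" for z
            by (rule holomorphic_derivI[OF h open_ball that])
          have "(F has_field_derivative 0) (at (of_real a))" "(F has_field_derivative 0) (at (of_real b))"
            unfolding F_def bump_def using ab inB
            by (auto intro!: derivative_eq_intros der)
          then show "F1 (of_real a) = 0" "F1 (of_real b) = 0"
            unfolding F1_def by (auto intro: DERIV_imp_deriv)
        qed
        then show "P (of_real b) = 0" "P (of_real a) = 0" by (auto simp: P_def F_def bump_def)
      qed
      ultimately have "integral {a..b} (\<lambda>t. ex (of_real t) * F (of_real t) - ex (of_real t) * F2 (of_real t) / c\<^sup>2) = 0"
        by (auto dest: integral_unique)
      then have I2: "I = integral {a..b} (\<lambda>t. ex (of_real t) * F2 (of_real t) / c\<^sup>2)"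
        unfolding I_def using cont[OF F_hol] cont[OF F2_hol] c
        by (subst (asm) integral_diff) (auto intro!: integrable_continuous_real continuous_on_divide continuous_on_const)
      have "norm I \<le> (32 * A * M / \<rho>\<^sup>2 / (real_of_int n)\<^sup>2) * (b - a)"
        unfolding I2
      proof (rule integral_bound)
        show "continuous_on {a..b} (\<lambda>t. ex (of_real t) * F2 (of_real t) / c\<^sup>2)"
          using c by (intro continuous_on_divide cont F2_hol continuous_on_const) simp
        fix t assume t: "t \<in> {a..b}"
        have "norm (ex (of_real t) * F2 (of_real t) / c\<^sup>2) = norm (F2 (of_real t)) / (real_of_int n)\<^sup>2"
          by (simp add: norm_divide norm_mult norm_power ex1 c_def)
        also have "\<dots> \<le> 32 * A * M / \<rho>\<^sup>2 / (real_of_int n)\<^sup>2"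
          by (intro divide_right_mono F2_le t) simp
        finally show "norm (ex (of_real t) * F2 (of_real t) / c\<^sup>2) \<le> 32 * A * M / \<rho>\<^sup>2 / (real_of_int n)\<^sup>2" .
      qed (use ab in simp)
      also have "\<dots> = D * M * (1 / (real_of_int n)\<^sup>2)" by (simp add: D_def)
      also have "\<dots> \<le> D * M * (2 / (1 + (real_of_int n)\<^sup>2))"
      proof (rule mult_left_mono)
        have "1 \<le> (real_of_int n)\<^sup>2" using False
          by (metis of_int_1_le_iff of_int_power one_le_power power2_eq_square zero_less_power2 int_one_le_iff_zero_less)
        then have "2 / ((real_of_int n)\<^sup>2 + (real_of_int n)\<^sup>2) \<le> 2 / (1 + (real_of_int n)\<^sup>2)"
          by (intro divide_left_mono mult_pos_pos) auto
        then show "1 / (real_of_int n)\<^sup>2 \<le> 2 / (1 + (real_of_int n)\<^sup>2)" by simp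
      qed (use \<open>D \<ge> 0\<close> \<open>M \<ge> 0\<close> in simp)
      also have "\<dots> = 2 * D * M / (1 + (real_of_int n)\<^sup>2)" by simp
      also have "\<dots> \<le> (2 * D + A * (b - a)) * M / (1 + (real_of_int n)\<^sup>2)"
        using \<open>A \<ge> 0\<close> \<open>M \<ge> 0\<close> ab by (intro divide_right_mono mult_right_mono) auto
      finally show ?thesis .
    qed
    then show "norm (integral {a..b} (\<lambda>t. exp (\<i> * of_int n * of_real t) * bump a b (of_real t) * h (of_real t)))
        \<le> (2 * D + A * (b - a)) * M / (1 + (real_of_int n)\<^sup>2)" unfolding I_eq .
  qed
qed

section \<open>Tails of the series with terms 1 / (1 + n^2)\<close>

lemma inverse_square_tail:
  assumes "d > 0"
  obtains k where "\<And>F. (\<And>n. n \<in> F \<Longrightarrow> k \<le> n) \<Longrightarrow> (\<Sum>n\<in>F. 1 / (1 + (real n)\<^sup>2)) < d"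
proof -
  let ?f = "\<lambda>n. 1 / (1 + (real n)\<^sup>2)"
  have "summable ?f"
  proof (rule summable_comparison_test'[where N = 1])
    show "summable (\<lambda>n. inverse (real n ^ 2))" by (rule inverse_power_summable) simp
    show "norm (?f n) \<le> inverse (real n ^ 2)" if "n \<ge> 1" for n
      using that by (auto simp: inverse_eq_divide intro!: divide_left_mono mult_pos_pos add_pos_nonneg)
  qed
  note sum = this
  obtain k where "norm (\<Sum>i. ?f (i + k)) < d"
    using suminf_exist_split[OF assms sum] by blast
  note k = this summable_ignore_initial_segment[OF sum, of k]
  show ?thesis
  proof (rule that[of k])
    fix F assume F: "\<And>n. n \<in> F \<Longrightarrow> k \<le> n"
    show "(\<Sum>n\<in>F. ?f n) < d"
    \<comment> \<open>For infinite \<open>F\<close> the sum is 0 by convention;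
      \<open>adapted_family\<close> likewise quantifies over all sets \<open>F\<close>.\<close>
    proof (cases "finite F")
      case True
      have "(\<Sum>n\<in>F. ?f n) = (\<Sum>i\<in>(\<lambda>n. n - k) ` F. ?f (i + k))"
        using F by (subst sum.reindex) (auto simp: inj_on_def eq_diff_iff o_def intro!: sum.cong)
      also have "\<dots> \<le> (\<Sum>i. ?f (i + k))"
        using True by (intro sum_le_suminf k(2)) auto
      finally show ?thesis using k(1) by simp
    qed (use assms in simp)
  qed
qed

text \<open>The indices above and below \<open>m\<close> form two one-sided tails in |n - m|, each
  below d / 2, wherever \<open>m\<close> lies.\<close>

lemma inverse_square_tail_shifted:
  assumes "d > 0"
  obtains k where "\<And>F m. (\<And>n. n \<in> F \<Longrightarrow> int k \<le> \<bar>int n - int m\<bar>) \<Longrightarrow>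
    (\<Sum>n\<in>F. 1 / (1 + (real_of_int (int m - int n))\<^sup>2)) < d"
proof -
  obtain k where k: "\<And>F. (\<And>n. n \<in> F \<Longrightarrow> k \<le> n) \<Longrightarrow> (\<Sum>n\<in>F. 1 / (1 + (real n)\<^sup>2)) < d / 2"
    using inverse_square_tail[of "d / 2"] assms by auto
  show ?thesis
  proof (rule that[of k])
    fix F m assume F: "\<And>n. n \<in> F \<Longrightarrow> int k \<le> \<bar>int n - int m\<bar>"
    let ?f = "\<lambda>n. 1 / (1 + (real_of_int (int m - int n))\<^sup>2)"
    show "(\<Sum>n\<in>F. ?f n) < d"
    proof (cases "finite F")
      case True
      have "(\<Sum>n\<in>{n\<in>F. m \<le> n}. ?f n) = (\<Sum>i\<in>(\<lambda>n. n - m) ` {n\<in>F. m \<le> n}. 1 / (1 + (real i)\<^sup>2))"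
        by (subst sum.reindex)
          (auto simp: inj_on_def eq_diff_iff o_def of_nat_diff power2_commute intro!: sum.cong)
      also have "\<dots> < d / 2" by (rule k) (use F in force)
      finally have 1: "(\<Sum>n\<in>{n\<in>F. m \<le> n}. ?f n) < d / 2" .
      have "(\<Sum>n\<in>{n\<in>F. \<not> m \<le> n}. ?f n) = (\<Sum>i\<in>(\<lambda>n. m - n) ` {n\<in>F. \<not> m \<le> n}. 1 / (1 + (real i)\<^sup>2))"
        by (subst sum.reindex) (auto simp: inj_on_def o_def of_nat_diff intro!: sum.cong)
      also have "\<dots> < d / 2" by (rule k) (use F in force)
      finally have 2: "(\<Sum>n\<in>{n\<in>F. \<not> m \<le> n}. ?f n) < d / 2" .
      have "(\<Sum>n\<in>F. ?f n) = (\<Sum>n\<in>{n\<in>F. m \<le> n} \<union> {n\<in>F. \<not> m \<le> n}. ?f n)"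
        by (rule arg_cong[where f = "sum ?f"]) auto
      also have "\<dots> = (\<Sum>n\<in>{n\<in>F. m \<le> n}. ?f n) + (\<Sum>n\<in>{n\<in>F. \<not> m \<le> n}. ?f n)"
        by (rule sum.union_disjoint) (use True in auto)
      finally show ?thesis using 1 2 by linarith
    qed (use assms in simp)
  qed
qed

section \<open>Families of oscillatory superpositions of eigenvectors\<close>

context frechet
begin

text \<open>A neighbourhood \<open>W\<close> of 0 is absorbing, so finitely many multiples of it
  cover \<open>K\<close>, and functionals bounded by 1 on \<open>W\<close> are bounded by a common
  \<open>M\<close> on \<open>K\<close>. Estimates may thus use only the values of a functional on
  \<open>K\<close>.\<close>

lemma compact_weak_nhd:
  assumes V: "open V" "(0::'a) \<in> V" and K: "compact K"
  obtains M where "M > 0"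
    "\<And>w. (\<And>l. functional l \<Longrightarrow> \<forall>x\<in>K. norm (l x) \<le> M \<Longrightarrow> norm (l w) < 1) \<Longrightarrow> w \<in> V"
proof -
  obtain W where W: "open W" "0 \<in> W"
    "\<And>w. (\<And>l. functional l \<Longrightarrow> \<forall>x\<in>W. norm (l x) \<le> 1 \<Longrightarrow> norm (l w) < 1) \<Longrightarrow> w \<in> V"
    by (rule weak_nhd[OF V]) blast
  define U where "U = (\<lambda>n::nat. sm (of_real (1 / real (Suc n))) -` W)"
  have U_open: "open (U n)" for n
    unfolding U_def by (intro open_vimage W continuous_on_sm continuous_on_const continuous_on_id)
  have cover: "K \<subseteq> (\<Union>n\<in>UNIV. U n)"
  proof
    fix x assume "x \<in> K"
    have "(\<lambda>n. 1 / real (Suc n)) \<longlonglongrightarrow> 0"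
      using LIMSEQ_inverse_real_of_nat by (simp add: inverse_eq_divide)
    then have "(\<lambda>n. sm (of_real (1 / real (Suc n))) x) \<longlonglongrightarrow> sm (of_real 0) x"
      by (intro tendsto_sm tendsto_of_real tendsto_const)
    then have "\<forall>\<^sub>F n in sequentially. sm (of_real (1 / real (Suc n))) x \<in> W"
      by (rule topological_tendstoD) (use W in auto)
    then obtain n where "sm (of_real (1 / real (Suc n))) x \<in> W"
      by (auto simp: eventually_sequentially)
    then show "x \<in> (\<Union>n\<in>UNIV. U n)" unfolding U_def by blast
  qed
  obtain C where C: "finite C" "K \<subseteq> (\<Union>n\<in>C. U n)"
    by (rule compactE_image[OF K U_open cover])
  define M where "M = real (Suc (Max (insert 0 C)))"
  show ?thesis
  proof (rule that[of M])
    show "M > 0" by (simp add: M_def)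
    fix w assume w: "\<And>l. functional l \<Longrightarrow> \<forall>x\<in>K. norm (l x) \<le> M \<Longrightarrow> norm (l w) < 1"
    show "w \<in> V"
    proof (rule W(3), rule w)
      fix l assume l: "functional l" "\<forall>x\<in>W. norm (l x) \<le> 1"
      show "\<forall>x\<in>K. norm (l x) \<le> M"
      proof
        fix x assume "x \<in> K"
        then obtain n where n: "n \<in> C" "sm (of_real (1 / real (Suc n))) x \<in> W"
          using C(2) unfolding U_def by blast
        have "norm (l (sm (of_real (1 / real (Suc n))) x)) \<le> 1" using l(2) n(2) by blast
        then have "norm (l x) \<le> real (Suc n)"
          by (simp add: functional_scale[OF l(1)] norm_mult norm_divide field_simps del: of_nat_Suc)
        also have "\<dots> \<le> M" unfolding M_def using n(1) C(1) by (intro of_nat_mono) auto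
        finally show "norm (l x) \<le> M" .
      qed
    qed
  qed
qed

lemma functional_compose:
  assumes "functional l" "cont_lin_op sm T"
  shows "functional (\<lambda>x. l (T x))"
  using assms unfolding functional_def cont_lin_op_def
  by (auto simp: Vector_Spaces.linear_iff intro: continuous_on_compose2)

lemma vholomorphic_functional:
  assumes E: "vholomorphic_on sm E Om" and l: "functional l" and "open Om"
  shows "(\<lambda>z. l (E z)) holomorphic_on Om"
  unfolding holomorphic_on_open[OF \<open>open Om\<close>]
proof
  fix z assume "z \<in> Om"
  then obtain D where D: "((\<lambda>h. sm (inverse h) (E (z + h) - E z)) \<longlongrightarrow> D) (at 0)"
    using E unfolding vholomorphic_on_def by blast
  have "((\<lambda>h. (l (E (z + h)) - l (E z)) / h) \<longlongrightarrow> l D) (at 0)"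
    using functional_tendsto[OF l D]
    by (simp add: functional_scale[OF l] functional_diff[OF l] divide_inverse mult.commute)
  then show "\<exists>f'. ((\<lambda>z. l (E z)) has_field_derivative f') (at z)"
    unfolding DERIV_def by blast
qed

lemma vholomorphic_continuous:
  assumes E: "vholomorphic_on sm E Om"
  shows "continuous_on Om E"
proof (rule continuous_at_imp_continuous_on, rule ballI)
  fix z assume "z \<in> Om"
  then obtain D where D: "((\<lambda>h. sm (inverse h) (E (z + h) - E z)) \<longlongrightarrow> D) (at 0)"
    using E unfolding vholomorphic_on_def by blast
  have "((\<lambda>h. sm h (sm (inverse h) (E (z + h) - E z)) + E z) \<longlongrightarrow> sm 0 D + E z) (at 0)"
    by (intro tendsto_plus tendsto_sm D tendsto_ident_at tendsto_const)
  moreover have "\<forall>\<^sub>F h in at 0. sm h (sm (inverse h) (E (z + h) - E z)) + E z = E (z + h)"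
    by (auto simp: eventually_at intro!: exI[of _ 1])
  ultimately have "((\<lambda>h. E (z + h)) \<longlongrightarrow> E z) (at 0)"
    by (rule Lim_transform_eventually[THEN tendsto_eq_rhs]) simp
  then show "isCont E z" by (simp add: isCont_iff)
qed

text \<open>Finite sums with repetition are closed under addition only. The hypothesis on multiples
  makes the closure a linear subspace, to which \<open>annihilator\<close> applies.\<close>

lemma closure_range_sum_list_eq_UNIV:
  fixes g :: "nat \<Rightarrow> 'a"
  assumes scale: "\<And>c s. sm c (g s) \<in> closure (range (\<lambda>xs. \<Sum>s\<leftarrow>xs. g s))"
    and sep: "\<And>l. functional l \<Longrightarrow> (\<And>s. l (g s) = 0) \<Longrightarrow> (\<And>x. l x = 0)"
  shows "closure (range (\<lambda>xs. \<Sum>s\<leftarrow>xs. g s)) = UNIV"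
proof (rule ccontr)
  let ?R = "range (\<lambda>xs. \<Sum>s\<leftarrow>xs. g s)"
  let ?C = "closure ?R"
  have sum_in: "(\<Sum>s\<leftarrow>xs. g s) \<in> ?C" for xs using closure_subset[of ?R] by blast
  have R_add: "x + y \<in> ?R" if xy: "x \<in> ?R" "y \<in> ?R" for x y
  proof -
    obtain xs ys where "x = (\<Sum>s\<leftarrow>xs. g s)" "y = (\<Sum>s\<leftarrow>ys. g s)" using xy by blast
    then have "x + y = (\<Sum>s\<leftarrow>xs @ ys. g s)" by simp
    then show ?thesis by blast
  qed
  have add1: "x + y \<in> ?C" if x: "x \<in> ?C" and y: "y \<in> ?R" for x y
  proof -
    have "(\<lambda>x. x + y) ` ?C \<subseteq> ?C"
      using R_add[OF _ y] closure_subset[of ?R]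
      by (intro image_closure_subset continuous_on_plus continuous_on_id continuous_on_const) auto
    then show ?thesis using x by blast
  qed
  have add: "x + y \<in> ?C" if x: "x \<in> ?C" and y: "y \<in> ?C" for x y
  proof -
    have "(\<lambda>y. x + y) ` ?C \<subseteq> ?C"
      using add1[OF x]
      by (intro image_closure_subset continuous_on_plus continuous_on_id continuous_on_const) auto
    then show ?thesis using y by blast
  qed
  have zero: "0 \<in> ?C" using sum_in[of "[]"] by simp
  have "sm c (\<Sum>s\<leftarrow>xs. g s) \<in> ?C" for c xs
    by (induction xs) (simp_all add: zero scale_right_distrib add scale)
  then have "sm c ` ?C \<subseteq> ?C" for c
    by (intro image_closure_subset continuous_on_sm continuous_on_id continuous_on_const) auto
  then have sc: "sm c x \<in> ?C" if "x \<in> ?C" for c x using that by blast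
  assume "?C \<noteq> UNIV"
  then obtain x where "x \<notin> ?C" by blast
  then obtain l where l: "functional l" "\<And>y. y \<in> ?C \<Longrightarrow> l y = 0" "l x \<noteq> 0"
    using annihilator[OF closed_closure zero add sc] by blast
  have "l (g s) = 0" for s using l(2)[OF sum_in[of "[s]"]] by simp
  from sep[OF l(1) this] l(3) show False by blast
qed

end

text \<open>Rational end points suffice: if h t0 \<noteq> 0, a short rational interval around t0
  carries a nonnegative integrand that is positive at t0. This keeps the family of vectors
  countable.\<close>

lemma vanishing_bump_integrals:
  fixes h :: "real \<Rightarrow> complex" and \<theta> \<delta> :: real
  assumes h: "continuous_on {\<theta> - \<delta>..\<theta> + \<delta>} h"
    and int: "\<And>a b :: rat. \<theta> - \<delta> \<le> of_rat a \<Longrightarrow> a < b \<Longrightarrow> of_rat b \<le> \<theta> + \<delta> \<Longrightarrow>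
      integral {of_rat a..of_rat b} (\<lambda>t. bump (of_rat a) (of_rat b) (of_real t) * h t) = 0"
    and t0: "\<bar>t0 - \<theta>\<bar> < \<delta>"
  shows "h t0 = 0"
proof (rule ccontr)
  assume "h t0 \<noteq> 0"
  have "continuous_on {\<theta> - \<delta><..<\<theta> + \<delta>} h" by (rule continuous_on_subset[OF h]) auto
  moreover have "t0 \<in> {\<theta> - \<delta><..<\<theta> + \<delta>}" using t0 by auto
  ultimately have "isCont h t0" by (simp add: continuous_on_eq_continuous_at)
  \<comment> \<open>Multiplication by the conjugate of h t0 rotates the values near t0 into the
    right half plane, reducing the claim to a real integrand.\<close>
  then have "((\<lambda>t. Re (h t * cnj (h t0))) \<longlongrightarrow> Re (h t0 * cnj (h t0))) (at t0)"
    unfolding isCont_def by (intro tendsto_intros)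
  moreover have pos0: "Re (h t0 * cnj (h t0)) > 0"
    using \<open>h t0 \<noteq> 0\<close> by (simp add: complex_mult_cnj complex_neq_0)
  ultimately have "\<forall>\<^sub>F t in at t0. Re (h t * cnj (h t0)) > 0" by (rule order_tendstoD)
  then obtain d where d: "d > 0" "\<And>t. t \<noteq> t0 \<Longrightarrow> dist t t0 < d \<Longrightarrow> Re (h t * cnj (h t0)) > 0"
    by (auto simp: eventually_at)
  have pos: "Re (h t * cnj (h t0)) > 0" if "\<bar>t - t0\<bar> < d" for t
    using d(2)[of t] pos0 that by (cases "t = t0") (auto simp: dist_real_def)
  have lt: "max (\<theta> - \<delta>) (t0 - d) < t0" "t0 < min (\<theta> + \<delta>) (t0 + d)"
    using t0 d(1) by (auto simp: abs_less_iff)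
  obtain a where a: "max (\<theta> - \<delta>) (t0 - d) < of_rat a" "of_rat a < t0"
    using of_rat_dense[OF lt(1)] by blast
  obtain b where b: "t0 < of_rat b" "of_rat b < min (\<theta> + \<delta>) (t0 + d)"
    using of_rat_dense[OF lt(2)] by blast
  have "a < b" using a b by (metis less_trans of_rat_less)
  define A B where "A = real_of_rat a" and "B = real_of_rat b"
  have AB: "\<theta> - \<delta> < A" "t0 - d < A" "A < t0" "t0 < B" "B < \<theta> + \<delta>" "B < t0 + d"
    using a b by (auto simp: A_def B_def)
  define w where "w = (\<lambda>t. (t - A)\<^sup>2 * (t - B)\<^sup>2)"
  have w: "bump A B (of_real t) = of_real (w t)" for t by (simp add: bump_def w_def)
  have cont_h: "continuous_on {A..B} h" by (rule continuous_on_subset[OF h]) (use AB in auto)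
  have cont: "continuous_on {A..B} (\<lambda>t. of_real (w t) * h t)"
    unfolding w_def by (intro continuous_intros cont_h)
  have lin: "bounded_linear (\<lambda>z. Re (z * cnj (h t0)))"
    by (intro bounded_linear_compose[OF bounded_linear_Re] bounded_linear_mult_left)
  have "integral {A..B} (\<lambda>t. of_real (w t) * h t) = 0"
    using int[of a b] \<open>a < b\<close> AB w by (simp add: A_def[symmetric] B_def[symmetric])
  then have "integral {A..B} ((\<lambda>z. Re (z * cnj (h t0))) \<circ> (\<lambda>t. of_real (w t) * h t)) = 0"
    by (subst integral_linear[OF integrable_continuous_real[OF cont] lin]) simp
  then have "integral {A..B} (\<lambda>t. w t * Re (h t * cnj (h t0))) = 0"
    by (simp add: o_def algebra_simps)
  moreover have "continuous_on {A..B} (\<lambda>t. w t * Re (h t * cnj (h t0)))"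
    unfolding w_def by (intro continuous_intros cont_h)
  moreover have "0 \<le> w t * Re (h t * cnj (h t0))" if "t \<in> {A..B}" for t
  proof -
    have "\<bar>t - t0\<bar> < d" using that AB by (auto simp: abs_less_iff)
    then show ?thesis by (intro mult_nonneg_nonneg less_imp_le[OF pos]) (simp add: w_def)
  qed
  ultimately have "w t0 * Re (h t0 * cnj (h t0)) = 0"
    using integral_eq_0_iff[of A B "\<lambda>t. w t * Re (h t * cnj (h t0))"] AB by auto
  then show False using pos0 AB by (auto simp: w_def)
qed

context frechet
begin

text \<open>The family consists of multiples of oscillatory integrals with rational end points and
  coefficients from a countable dense set of scalars, since the criterion needs a sequence and
  finite sums supply only natural multiplicities.\<close>

lemma eigenvector_family:
  fixes T :: "'i \<Rightarrow> 'a \<Rightarrow> 'a" and \<phi> :: "'i \<Rightarrow> complex \<Rightarrow> complex" and E :: "complex \<Rightarrow> 'a"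
  assumes J: "finite J" "i \<in> J" and T: "\<And>j. j \<in> J \<Longrightarrow> cont_lin_op sm (T j)"
    and Om: "open Om" "connected Om" and E: "vholomorphic_on sm E Om"
    and span: "closure (span (E ` Om)) = UNIV"
    and eigen: "\<And>j z. j \<in> J \<Longrightarrow> z \<in> Om \<Longrightarrow> T j (E z) = sm (\<phi> j z) (E z)"
    and hol: "\<And>j. j \<in> J \<Longrightarrow> \<phi> j holomorphic_on Om"
    and nc: "\<not> \<phi> i constant_on Om"
    and z0: "z0 \<in> Om" "norm (\<phi> i z0) = 1" "\<And>j. j \<in> J \<Longrightarrow> j \<noteq> i \<Longrightarrow> norm (\<phi> j z0) < 1"
  shows "\<exists>e. adapted_family J T i e"
proof -
  obtain \<gamma> \<theta> \<rho> r where \<rho>: "0 < \<rho>" "\<rho> \<le> 1" and r: "0 \<le> r" "r < 1"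
    and \<gamma>_hol: "\<gamma> holomorphic_on (ball (of_real \<theta>) (2 * \<rho>))"
    and \<gamma>_Om: "\<And>z. z \<in> ball (of_real \<theta>) (2 * \<rho>) \<Longrightarrow> \<gamma> z \<in> Om"
    and \<gamma>_i: "\<And>z. z \<in> ball (of_real \<theta>) (2 * \<rho>) \<Longrightarrow> \<phi> i (\<gamma> z) = exp (\<i> * z)"
    and \<gamma>_j: "\<And>z j. z \<in> ball (of_real \<theta>) (2 * \<rho>) \<Longrightarrow> j \<in> J \<Longrightarrow> j \<noteq> i \<Longrightarrow> norm (\<phi> j (\<gamma> z)) \<le> r"
    by (rule unimodular_chart[where \<phi> = \<phi>, OF Om J hol nc z0]) blast+
  let ?c = "complex_of_real \<theta>"
  have cball_sub: "cball ?c \<rho> \<subseteq> ball ?c (2 * \<rho>)" using \<rho> by auto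
  have ball_sub: "ball ?c \<rho> \<subseteq> ball ?c (2 * \<rho>)" using \<rho> by auto
  have \<gamma>_cont: "continuous_on (ball ?c (2 * \<rho>)) \<gamma>" by (rule holomorphic_on_imp_continuous_on[OF \<gamma>_hol])
  have E\<gamma>_cont: "continuous_on (ball ?c (2 * \<rho>)) (\<lambda>z. E (\<gamma> z))"
    by (rule continuous_on_compose2[OF vholomorphic_continuous[OF E] \<gamma>_cont]) (use \<gamma>_Om in blast)
  define K where "K = (\<lambda>z. E (\<gamma> z)) ` cball ?c \<rho>"
  have K: "compact K"
    unfolding K_def
    by (intro compact_continuous_image continuous_on_subset[OF E\<gamma>_cont cball_sub] compact_cball)
  define valid where "valid = (\<lambda>a b. \<theta> - \<rho> / 2 \<le> a \<and> a < b \<and> b \<le> \<theta> + \<rho> / 2)"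
  have in_ball: "complex_of_real t \<in> ball ?c \<rho>" if "valid a b" "t \<in> {a..b}" for a b t
  proof -
    have "dist ?c (of_real t) = \<bar>\<theta> - t\<bar>" by (metis dist_of_real dist_real_def)
    moreover have "\<bar>\<theta> - t\<bar> \<le> \<rho> / 2" using that unfolding valid_def atLeastAtMost_iff by linarith
    ultimately show ?thesis using \<rho> by simp
  qed
  have in_ball2: "complex_of_real t \<in> ball ?c (2 * \<rho>)" if "valid a b" "t \<in> {a..b}" for a b t
    using in_ball[OF that] ball_sub by blast
  define osc where "osc = (\<lambda>a b n t. exp (\<i> * of_int n * of_real t) * bump a b (complex_of_real t))"
  have ex_v: "\<exists>v. \<forall>l. functional l \<longrightarrow> l v = integral {a..b} (\<lambda>t. osc a b n t * l (E (\<gamma> (of_real t))))"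
    if ab: "valid a b" for a b n
  proof -
    have "continuous_on {a..b} (\<lambda>t. E (\<gamma> (of_real t)))"
      by (rule continuous_on_compose2[OF E\<gamma>_cont]) (use in_ball2[OF ab] in \<open>auto intro: continuous_intros\<close>)
    then have "continuous_on {a..b} (\<lambda>t. sm (osc a b n t) (E (\<gamma> (of_real t))))"
      unfolding osc_def bump_def by (intro continuous_on_sm continuous_intros)
    then obtain v where "\<And>l. functional l \<Longrightarrow>
        l v = integral {a..b} (\<lambda>t. l (sm (osc a b n t) (E (\<gamma> (of_real t)))))"
      by (rule weak_integral_exists) (use ab in \<open>auto simp: valid_def\<close>)
    then show ?thesis by (auto simp: functional_scale)
  qed
  define v where "v = (\<lambda>a b n. SOME v. \<forall>l. functional l \<longrightarrow>
    l v = integral {a..b} (\<lambda>t. osc a b n t * l (E (\<gamma> (of_real t)))))"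
  have v: "l (v a b n) = integral {a..b} (\<lambda>t. osc a b n t * l (E (\<gamma> (of_real t))))"
    if "valid a b" "functional l" for a b n l
    using someI_ex[OF ex_v[OF that(1), of n]] that(2) unfolding v_def by blast
  have T_pow: "(T j ^^ m) (E z) = sm (\<phi> j z ^ m) (E z)" if "j \<in> J" "z \<in> Om" for j m z
    by (induction m) (simp_all add: cont_lin_op_scale[OF T[OF that(1)]] eigen[OF that] mult.commute)
  have T_v: "l ((T j ^^ m) (v a b n))
      = integral {a..b} (\<lambda>t. osc a b n t * (\<phi> j (\<gamma> (of_real t)) ^ m * l (E (\<gamma> (of_real t)))))"
    if "valid a b" "functional l" "j \<in> J" for a b n l j m
  proof -
    have "l ((T j ^^ m) (v a b n)) = integral {a..b} (\<lambda>t. osc a b n t * l ((T j ^^ m) (E (\<gamma> (of_real t)))))"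
      by (rule v[OF that(1) functional_compose[OF that(2) cont_lin_op_pow[OF T[OF that(3)]]]])
    also have "\<dots> = integral {a..b} (\<lambda>t. osc a b n t * (\<phi> j (\<gamma> (of_real t)) ^ m * l (E (\<gamma> (of_real t)))))"
      by (intro Henstock_Kurzweil_Integration.integral_cong)
        (simp add: T_pow[OF that(3) \<gamma>_Om[OF in_ball2[OF that(1)]]] functional_scale[OF that(2)])
    finally show ?thesis .
  qed
  \<comment> \<open>Along the real interval the eigenvalue of \<open>T i\<close> is exp (i t), so
    each application raises the frequency by one.\<close>
  have T_i_v: "(T i ^^ m) (v a b n) = v a b (n + int m)" if ab: "valid a b" for a b n m
  proof (rule functional_separates)
    fix l assume l: "functional l"
    have "osc a b n t * \<phi> i (\<gamma> (of_real t)) ^ m = osc a b (n + int m) t" if "t \<in> {a..b}" for t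
      unfolding osc_def \<gamma>_i[OF in_ball2[OF ab that]]
      by (simp add: exp_of_nat_mult[symmetric] exp_add[symmetric] algebra_simps)
    then show "l ((T i ^^ m) (v a b n)) = l (v a b (n + int m))"
      unfolding T_v[OF ab l J(2)] v[OF ab l]
      by (intro Henstock_Kurzweil_Integration.integral_cong) (simp add: mult.assoc[symmetric])
  qed
  have l_hol: "(\<lambda>z. l (E (\<gamma> z))) holomorphic_on (ball ?c (2 * \<rho>))" if "functional l" for l
  proof -
    have "(\<lambda>z. l (E z)) \<circ> \<gamma> holomorphic_on (ball ?c (2 * \<rho>))"
      by (rule holomorphic_on_compose_gen[OF \<gamma>_hol vholomorphic_functional[OF E that Om(1)]])
        (use \<gamma>_Om in blast)
    then show ?thesis by (simp add: o_def)
  qed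
  define decay where "decay = (\<lambda>a b C. C \<ge> 0 \<and> (\<forall>h M n. h holomorphic_on (ball ?c \<rho>) \<longrightarrow>
      (\<forall>z\<in>ball ?c \<rho>. norm (h z) \<le> M) \<longrightarrow>
      norm (integral {a..b} (\<lambda>t. osc a b n t * h (of_real t))) \<le> C * M / (1 + (real_of_int n)\<^sup>2)))"
  have decay_ex: "\<exists>C. decay a b C" if ab: "valid a b" for a b
  proof -
    have ab': "\<theta> - \<rho> / 2 \<le> a" "a < b" "b \<le> \<theta> + \<rho> / 2" using ab unfolding valid_def by blast+
    obtain C where "C \<ge> 0" and C: "\<And>h M n. h holomorphic_on (ball ?c \<rho>) \<Longrightarrow>
        (\<And>z. z \<in> ball ?c \<rho> \<Longrightarrow> norm (h z) \<le> M) \<Longrightarrow>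
        norm (integral {a..b} (\<lambda>t. exp (\<i> * of_int n * of_real t) * bump a b (of_real t) * h (of_real t)))
          \<le> C * M / (1 + (real_of_int n)\<^sup>2)"
      by (rule oscillatory_decay[OF \<rho>(1) ab']) blast
    then have "decay a b C" unfolding decay_def osc_def by blast
    then show ?thesis ..
  qed
  define C where "C = (\<lambda>a b. SOME C. decay a b C)"
  have C: "decay a b (C a b)" if "valid a b" for a b
    unfolding C_def by (rule someI_ex[OF decay_ex[OF that]])
  have C_nonneg: "C a b \<ge> 0" if "valid a b" for a b
    using C[OF that] unfolding decay_def by blast
  have C_bound: "norm (integral {a..b} (\<lambda>t. osc a b n t * h (of_real t))) \<le> C a b * M / (1 + (real_of_int n)\<^sup>2)"
    if "valid a b" "h holomorphic_on (ball ?c \<rho>)" "\<And>z. z \<in> ball ?c \<rho> \<Longrightarrow> norm (h z) \<le> M" for a b h M n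
    using C[OF that(1)] that(2,3) unfolding decay_def by blast
  have l_bound: "norm (l (E (\<gamma> z))) \<le> M" if "\<forall>x\<in>K. norm (l x) \<le> M" "z \<in> ball ?c \<rho>" for l M z
    using that by (auto simp: K_def)
  have bound_i: "norm (l ((T i ^^ m) (v a b (- int n)))) \<le> C a b * M * (1 / (1 + (real_of_int (int m - int n))\<^sup>2))"
    if ab: "valid a b" and l: "functional l" and M: "\<forall>x\<in>K. norm (l x) \<le> M" for a b l M m n
  proof -
    have "norm (l (v a b (- int n + int m))) \<le> C a b * M / (1 + (real_of_int (- int n + int m))\<^sup>2)"
      unfolding v[OF ab l]
      by (rule C_bound[OF ab holomorphic_on_subset[OF l_hol[OF l] ball_sub] l_bound[OF M]])
    then show ?thesis unfolding T_i_v[OF ab] by (simp add: add.commute)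
  qed
  \<comment> \<open>Here the power of the eigenvalue is absorbed into the amplitude, whose bound
    becomes \<open>r ^ m * M\<close>, and the frequency remains - n.\<close>
  have bound_j: "norm (l ((T j ^^ m) (v a b (- int n)))) \<le> C a b * (r ^ m * M) * (1 / (1 + (real n)\<^sup>2))"
    if ab: "valid a b" and l: "functional l" and M: "\<forall>x\<in>K. norm (l x) \<le> M" and j: "j \<in> J" "j \<noteq> i"
    for a b l M m n j
  proof -
    have "(\<phi> j \<circ> \<gamma>) holomorphic_on (ball ?c (2 * \<rho>))"
      by (rule holomorphic_on_compose_gen[OF \<gamma>_hol hol[OF j(1)]]) (use \<gamma>_Om in blast)
    then have "(\<lambda>z. \<phi> j (\<gamma> z)) holomorphic_on (ball ?c \<rho>)"
      using holomorphic_on_subset[OF _ ball_sub] by (simp add: o_def)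
    then have "(\<lambda>z. \<phi> j (\<gamma> z) ^ m * l (E (\<gamma> z))) holomorphic_on (ball ?c \<rho>)"
      by (intro holomorphic_intros holomorphic_on_subset[OF l_hol[OF l] ball_sub])
    moreover have "norm (\<phi> j (\<gamma> z) ^ m * l (E (\<gamma> z))) \<le> r ^ m * M" if "z \<in> ball ?c \<rho>" for z
      unfolding norm_mult norm_power using r(1) ball_sub that
      by (intro mult_mono power_mono l_bound[OF M] \<gamma>_j j) auto
    ultimately have "norm (l ((T j ^^ m) (v a b (- int n)))) \<le> C a b * (r ^ m * M) / (1 + (real_of_int (- int n))\<^sup>2)"
      unfolding T_v[OF ab l j(1)] by (rule C_bound[OF ab])
    then show ?thesis by simp
  qed
  obtain D :: "complex set" where D: "countable D" "\<And>X. open X \<Longrightarrow> X \<noteq> {} \<Longrightarrow> \<exists>d\<in>D. d \<in> X"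
    using countable_dense_exists by metis
  have "D \<noteq> {}" using D(2)[of UNIV] by auto
  define code where "code = (\<lambda>s. from_nat s :: nat \<times> rat \<times> rat)"
  define A where "A = (\<lambda>s. real_of_rat (fst (snd (code s))))"
  define B where "B = (\<lambda>s. real_of_rat (snd (snd (code s))))"
  define coef where "coef = (\<lambda>s. from_nat_into D (fst (code s)))"
  \<comment> \<open>Codes of inadmissible intervals yield the zero vector, for which every condition
    is trivial.\<close>
  define e where "e = (\<lambda>s n. if valid (A s) (B s) then sm (coef s) (v (A s) (B s) (- int n)) else 0)"
  have T_e: "(T j ^^ m) (e s n) = (if valid (A s) (B s) then sm (coef s) ((T j ^^ m) (v (A s) (B s) (- int n))) else 0)"
    if "j \<in> J" for j m s n
    using cont_lin_op_pow[OF T[OF that], of m]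
    by (simp add: e_def cont_lin_op_scale cont_lin_op_0)
  have e_surj: "\<exists>s. A s = real_of_rat a \<and> B s = real_of_rat b \<and> coef s = c" if c: "c \<in> D" for a b c
  proof -
    obtain k where "from_nat_into D k = c" using from_nat_into_surj[OF D(1) c] by blast
    then show ?thesis
      by (intro exI[of _ "to_nat (k, a, b)"]) (simp add: A_def B_def coef_def code_def)
  qed
  have dense: "closure (range (\<lambda>xs. \<Sum>s\<leftarrow>xs. e s 0)) = UNIV" (is "closure ?R = UNIV")
  proof (rule closure_range_sum_list_eq_UNIV)
    have gen: "sm c (v (of_rat a) (of_rat b) 0) \<in> closure ?R" if ab: "valid (of_rat a) (of_rat b)" for a b c
    proof -
      have "(\<lambda>c. sm c (v (of_rat a) (of_rat b) 0)) ` closure D \<subseteq> closure ?R"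
      proof (rule image_closure_subset)
        show "continuous_on (closure D) (\<lambda>c. sm c (v (of_rat a) (of_rat b) 0))"
          by (intro continuous_on_sm continuous_on_id continuous_on_const)
        show "(\<lambda>c. sm c (v (of_rat a) (of_rat b) 0)) ` D \<subseteq> closure ?R"
        proof (rule image_subsetI)
          fix d assume "d \<in> D"
          then obtain s where "A s = real_of_rat a" "B s = real_of_rat b" "coef s = d"
            using e_surj by blast
          then have "sm d (v (of_rat a) (of_rat b) 0) = (\<Sum>s\<leftarrow>[s]. e s 0)"
            using ab by (simp add: e_def)
          then show "sm d (v (of_rat a) (of_rat b) 0) \<in> closure ?R"
            using closure_subset[of ?R] by blast
        qed
      qed simp
      moreover have "c \<in> closure D"
        unfolding closure_approachable
      proof (intro allI impI)
        fix d :: real assume "d > 0"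
        then obtain x where "x \<in> D" "x \<in> ball c d" using D(2)[of "ball c d"] by auto
        then show "\<exists>y\<in>D. dist y c < d" by (auto simp: dist_commute)
      qed
      ultimately show ?thesis by blast
    qed
    have zero: "0 \<in> closure ?R"
    proof -
      have "(0::'a) = (\<Sum>s\<leftarrow>[]. e s 0)" by simp
      then have "0 \<in> ?R" by blast
      then show ?thesis using closure_subset[of ?R] by blast
    qed
    show "sm c (e s 0) \<in> closure ?R" for c s
    proof (cases "valid (A s) (B s)")
      case True
      then have "sm (c * coef s) (v (A s) (B s) 0) \<in> closure ?R" unfolding A_def B_def by (rule gen)
      then show ?thesis using True by (simp add: e_def)
    next
      case False
      then have "e s 0 = 0" by (simp add: e_def)
      then show ?thesis using zero by simp
    qed
    fix l x assume l: "functional l" and l_e: "\<And>s. l (e s 0) = 0"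
    have l_v: "l (v (of_rat a) (of_rat b) 0) = 0" if ab: "valid (of_rat a) (of_rat b)" for a b
    proof -
      \<comment> \<open>A nonzero coefficient is needed in order to cancel it.\<close>
      obtain c where "c \<in> D" "c \<in> - {0}" using D(2)[of "- {0}"] by force
      moreover obtain s where "A s = real_of_rat a" "B s = real_of_rat b" "coef s = c"
        using e_surj \<open>c \<in> D\<close> by blast
      ultimately show ?thesis using l_e[of s] ab by (simp add: e_def functional_scale[OF l])
    qed
    define h where "h = (\<lambda>t. l (E (\<gamma> (complex_of_real t))))"
    have h0: "h t = 0" if "\<bar>t - \<theta>\<bar> < \<rho> / 2" for t
    proof (rule vanishing_bump_integrals[OF _ _ that])
      have "valid (\<theta> - \<rho> / 2) (\<theta> + \<rho> / 2)" using \<rho> by (simp add: valid_def)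
      from in_ball2[OF this] show "continuous_on {\<theta> - \<rho> / 2..\<theta> + \<rho> / 2} h"
        unfolding h_def
        by (intro continuous_on_compose2[OF holomorphic_on_imp_continuous_on[OF l_hol[OF l]]]
            continuous_on_of_real continuous_on_id) blast
      show "integral {of_rat a..of_rat b} (\<lambda>t. bump (of_rat a) (of_rat b) (of_real t) * h t) = 0"
        if "\<theta> - \<rho> / 2 \<le> of_rat a" "a < b" "of_rat b \<le> \<theta> + \<rho> / 2" for a b
      proof -
        have ab: "valid (of_rat a) (of_rat b)" using that by (simp add: valid_def of_rat_less)
        from l_v[OF ab] v[OF ab l, of 0] show ?thesis by (simp add: osc_def h_def)
      qed
    qed
    \<comment> \<open>A sequence tending to \<open>\<theta>\<close> but avoiding it, inside the
      interval where \<open>h\<close> vanishes. Its image under \<open>\<gamma>\<close> accumulates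
      at \<open>\<gamma> \<theta>\<close>, as the identity theorem on \<open>Om\<close>
      requires.\<close>
    define t where "t = (\<lambda>n::nat. \<theta> + \<rho> / 4 * (1 / real (Suc n)))"
    have t: "\<bar>t n - \<theta>\<bar> < \<rho> / 2" "t n \<noteq> \<theta>" for n
    proof -
      have "0 < 1 / real (Suc n)" "1 / real (Suc n) \<le> 1" by simp_all
      then have "0 < \<rho> / 4 * (1 / real (Suc n))" "\<rho> / 4 * (1 / real (Suc n)) \<le> \<rho> / 4 * 1"
        using \<rho>(1) by (intro mult_pos_pos mult_left_mono; simp)+
      then show "\<bar>t n - \<theta>\<bar> < \<rho> / 2" "t n \<noteq> \<theta>" using \<rho>(1) unfolding t_def by linarith+
    qed
    have t_ball: "complex_of_real (t n) \<in> ball ?c (2 * \<rho>)" for n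
    proof -
      have "dist ?c (of_real (t n)) = \<bar>\<theta> - t n\<bar>" by (metis dist_of_real dist_real_def)
      then show ?thesis unfolding mem_ball using t(1)[of n] \<rho> by linarith
    qed
    have "t \<longlonglongrightarrow> \<theta> + \<rho> / 4 * 0"
      unfolding t_def using LIMSEQ_inverse_real_of_nat
      by (intro tendsto_intros) (simp add: inverse_eq_divide)
    then have "(\<lambda>n. complex_of_real (t n)) \<longlonglongrightarrow> ?c" by (intro tendsto_of_real) simp
    moreover have "isCont \<gamma> ?c"
      using \<gamma>_cont \<rho> by (simp add: continuous_on_eq_continuous_at)
    ultimately have lim: "(\<lambda>n. \<gamma> (of_real (t n))) \<longlonglongrightarrow> \<gamma> ?c" by (rule isCont_tendsto_compose[rotated])
    have ne: "\<gamma> (of_real (t n)) \<noteq> \<gamma> ?c" for n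
    proof
      assume "\<gamma> (of_real (t n)) = \<gamma> ?c"
      moreover have "?c \<in> ball ?c (2 * \<rho>)" using \<rho> by simp
      ultimately have "exp (\<i> * of_real (t n)) = exp (\<i> * ?c)"
        using \<gamma>_i[OF t_ball[of n]] \<gamma>_i[of ?c] by metis
      moreover have "\<bar>Im (\<i> * of_real (t n)) - Im (\<i> * ?c)\<bar> < 2 * pi"
        using t(1)[of n] \<rho> pi_gt3 by simp
      ultimately have "\<i> * of_real (t n) = \<i> * ?c" by (metis exp_complex_eqI)
      with t(2)[of n] show False by simp
    qed
    have "l (E z) = 0" if z: "z \<in> Om" for z
    proof (rule analytic_continuation[where f = "\<lambda>z. l (E z)" and S = Om and U = "range (\<lambda>n. \<gamma> (of_real (t n)))"])
      show "(\<lambda>z. l (E z)) holomorphic_on Om" by (rule vholomorphic_functional[OF E l Om(1)])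
      show "\<gamma> ?c \<in> Om" using \<rho> by (intro \<gamma>_Om) simp
      show "\<gamma> ?c islimpt range (\<lambda>n. \<gamma> (of_real (t n)))"
        unfolding islimpt_sequential using lim ne by (intro exI[of _ "\<lambda>n. \<gamma> (of_real (t n))"]) auto
      show "l (E z) = 0" if "z \<in> range (\<lambda>n. \<gamma> (of_real (t n)))" for z
        using that h0[OF t(1)] by (auto simp: h_def)
      show "range (\<lambda>n. \<gamma> (of_real (t n))) \<subseteq> Om" using \<gamma>_Om[OF t_ball] by blast
    qed (use Om z in auto)
    then have "span (E ` Om) \<subseteq> {x. l x = 0}"
      by (intro span_minimal)
        (auto simp: subspace_def functional_0[OF l] functional_add[OF l] functional_scale[OF l])
    moreover have "closed {x. l x = 0}"
      using l unfolding functional_def by (intro closed_Collect_eq continuous_on_const) auto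
    ultimately have "closure (span (E ` Om)) \<subseteq> {x. l x = 0}" by (rule closure_minimal)
    then show "l x = 0" using span by auto
  qed
  have inverse: "(T i ^^ n) (e s n) = e s 0" for s n
    unfolding T_e[OF J(2)] by (simp add: e_def T_i_v)
  have diag: "\<exists>k. \<forall>m F. (\<forall>n\<in>F. int k \<le> \<bar>int n - int m\<bar>) \<longrightarrow>
      dist (\<Sum>n\<in>F. (T i ^^ m) (e s n)) 0 < d" if d: "d > 0" for s d
  proof (cases "valid (A s) (B s)")
    case False
    then show ?thesis using d by (simp add: T_e[OF J(2)])
  next
    case True
    obtain M where M: "M > 0"
      "\<And>w. (\<And>l. functional l \<Longrightarrow> \<forall>x\<in>K. norm (l x) \<le> M \<Longrightarrow> norm (l w) < 1) \<Longrightarrow> w \<in> ball 0 d"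
      using compact_weak_nhd[OF open_ball _ K, of 0 d] d by auto
    \<comment> \<open>This collects all factors independent of \<open>m\<close> and
      \<open>n\<close>. Tails below 1 / (Q + 1) give Q / (Q + 1) < 1, also when Q = 0.\<close>
    define Q where "Q = norm (coef s) * (C (A s) (B s) * M)"
    have "Q \<ge> 0" using C_nonneg[OF True] M(1) by (simp add: Q_def)
    obtain k where k: "\<And>F m. (\<And>n. n \<in> F \<Longrightarrow> int k \<le> \<bar>int n - int m\<bar>) \<Longrightarrow>
        (\<Sum>n\<in>F. 1 / (1 + (real_of_int (int m - int n))\<^sup>2)) < 1 / (Q + 1)"
      by (rule inverse_square_tail_shifted[of "1 / (Q + 1)"]) (use \<open>Q \<ge> 0\<close> in auto)
    show ?thesis
    proof (intro exI[of _ k] allI impI)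
      fix m F assume F: "\<forall>n\<in>F. int k \<le> \<bar>int n - int m\<bar>"
      have "(\<Sum>n\<in>F. (T i ^^ m) (e s n)) \<in> ball 0 d"
      proof (rule M(2))
        fix l assume l: "functional l" "\<forall>x\<in>K. norm (l x) \<le> M"
        let ?f = "\<lambda>n. 1 / (1 + (real_of_int (int m - int n))\<^sup>2)"
        have "norm (l (\<Sum>n\<in>F. (T i ^^ m) (e s n))) \<le> (\<Sum>n\<in>F. norm (l ((T i ^^ m) (e s n))))"
          unfolding functional_sum[OF l(1)] by (rule norm_sum)
        also have "\<dots> \<le> (\<Sum>n\<in>F. Q * ?f n)"
        proof (rule sum_mono)
          fix n
          show "norm (l ((T i ^^ m) (e s n))) \<le> Q * ?f n"
            using mult_left_mono[OF bound_i[OF True l, of m n], of "norm (coef s)"] True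
            by (simp add: T_e[OF J(2)] functional_scale[OF l(1)] norm_mult Q_def mult.assoc)
        qed
        also have "\<dots> = Q * (\<Sum>n\<in>F. ?f n)" by (simp add: sum_distrib_left)
        also have "\<dots> \<le> Q * (1 / (Q + 1))"
          using k[of F m] F \<open>Q \<ge> 0\<close> by (intro mult_left_mono) auto
        also have "\<dots> < 1" using \<open>Q \<ge> 0\<close> by simp
        finally show "norm (l (\<Sum>n\<in>F. (T i ^^ m) (e s n))) < 1" .
      qed
      then show "dist (\<Sum>n\<in>F. (T i ^^ m) (e s n)) 0 < d" by (simp add: dist_commute)
    qed
  qed
  have off_diag: "\<exists>k. \<forall>m F. (k \<le> m \<or> (\<forall>n\<in>F. k \<le> n)) \<longrightarrow>
      dist (\<Sum>n\<in>F. (T j ^^ m) (e s n)) 0 < d" if j: "j \<in> J" "j \<noteq> i" and d: "d > 0" for j s d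
  proof (cases "valid (A s) (B s)")
    case False
    then show ?thesis using d by (simp add: T_e[OF j(1)])
  next
    case True
    obtain M where M: "M > 0"
      "\<And>w. (\<And>l. functional l \<Longrightarrow> \<forall>x\<in>K. norm (l x) \<le> M \<Longrightarrow> norm (l w) < 1) \<Longrightarrow> w \<in> ball 0 d"
      using compact_weak_nhd[OF open_ball _ K, of 0 d] d by auto
    define Q where "Q = norm (coef s) * (C (A s) (B s) * M)"
    have "Q \<ge> 0" using C_nonneg[OF True] M(1) by (simp add: Q_def)
    let ?f = "\<lambda>n. 1 / (1 + (real n)\<^sup>2)"
    \<comment> \<open>For large \<open>m\<close> the index set is arbitrary, so a bound for all
      partial sums is needed and \<open>r ^ m\<close> supplies the smallness. For large
      \<open>n\<close> the tail is small and \<open>r ^ m\<close> is merely bounded by 1.\<close>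
    obtain S where S: "\<And>F. (\<Sum>n\<in>F. ?f n) \<le> S" "S \<ge> 0"
    proof -
      obtain k0 where k0: "\<And>F. (\<And>n. n \<in> F \<Longrightarrow> k0 \<le> n) \<Longrightarrow> (\<Sum>n\<in>F. ?f n) < 1"
        using inverse_square_tail[of 1] by auto
      show ?thesis
      proof (rule that[of "real k0 + 1"])
        fix F :: "nat set"
        show "(\<Sum>n\<in>F. ?f n) \<le> real k0 + 1"
        proof (cases "finite F")
          case True
          have "(\<Sum>n\<in>F. ?f n) = (\<Sum>n\<in>F \<inter> {..<k0}. ?f n) + (\<Sum>n\<in>F - {..<k0}. ?f n)"
            by (rule sum.Int_Diff[OF True])
          also have "(\<Sum>n\<in>F \<inter> {..<k0}. ?f n) \<le> (\<Sum>n\<in>F \<inter> {..<k0}. 1)"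
            by (intro sum_mono) (simp add: add_pos_nonneg)
          also have "\<dots> \<le> real k0"
            using card_mono[of "{..<k0}" "F \<inter> {..<k0}"] by simp
          also have "(\<Sum>n\<in>F - {..<k0}. ?f n) \<le> 1" using k0[of "F - {..<k0}"] by force
          finally show ?thesis by simp
        qed simp
      qed simp
    qed
    obtain k1 where k1: "\<And>F. (\<And>n. n \<in> F \<Longrightarrow> k1 \<le> n) \<Longrightarrow> (\<Sum>n\<in>F. ?f n) < 1 / (Q + 1)"
      by (rule inverse_square_tail[of "1 / (Q + 1)"]) (use \<open>Q \<ge> 0\<close> in auto)
    have QS: "0 \<le> Q * S" using \<open>Q \<ge> 0\<close> S(2) by simp
    obtain k2 where k2: "r ^ k2 < 1 / (Q * S + 1)"
      using real_arch_pow_inv[of "1 / (Q * S + 1)" r] r QS by auto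
    show ?thesis
    proof (intro exI[of _ "max k1 k2"] allI impI)
      fix m F assume F: "max k1 k2 \<le> m \<or> (\<forall>n\<in>F. max k1 k2 \<le> n)"
      have small: "Q * (r ^ m * (\<Sum>n\<in>F. ?f n)) < 1"
        using F
      proof
        assume "max k1 k2 \<le> m"
        then have "r ^ m \<le> r ^ k2" using r by (intro power_decreasing) auto
        then have "r ^ m * (\<Sum>n\<in>F. ?f n) \<le> 1 / (Q * S + 1) * S"
          using k2 S r QS by (intro mult_mono) (auto intro: sum_nonneg)
        then have "Q * (r ^ m * (\<Sum>n\<in>F. ?f n)) \<le> Q * (1 / (Q * S + 1) * S)"
          using \<open>Q \<ge> 0\<close> by (rule mult_left_mono)
        also have "\<dots> = Q * S / (Q * S + 1)" by simp
        also have "\<dots> < 1" using QS by simp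
        finally show ?thesis .
      next
        assume "\<forall>n\<in>F. max k1 k2 \<le> n"
        then have "(\<Sum>n\<in>F. ?f n) < 1 / (Q + 1)" by (intro k1) auto
        then have "r ^ m * (\<Sum>n\<in>F. ?f n) \<le> 1 * (1 / (Q + 1))"
          using r by (intro mult_mono power_le_one) (auto intro: sum_nonneg)
        then have "Q * (r ^ m * (\<Sum>n\<in>F. ?f n)) \<le> Q * (1 * (1 / (Q + 1)))"
          using \<open>Q \<ge> 0\<close> by (rule mult_left_mono)
        also have "\<dots> < 1" using \<open>Q \<ge> 0\<close> by simp
        finally show ?thesis .
      qed
      have "(\<Sum>n\<in>F. (T j ^^ m) (e s n)) \<in> ball 0 d"
      proof (rule M(2))
        fix l assume l: "functional l" "\<forall>x\<in>K. norm (l x) \<le> M"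
        have "norm (l (\<Sum>n\<in>F. (T j ^^ m) (e s n))) \<le> (\<Sum>n\<in>F. norm (l ((T j ^^ m) (e s n))))"
          unfolding functional_sum[OF l(1)] by (rule norm_sum)
        also have "\<dots> \<le> (\<Sum>n\<in>F. Q * r ^ m * ?f n)"
        proof (rule sum_mono)
          fix n
          show "norm (l ((T j ^^ m) (e s n))) \<le> Q * r ^ m * ?f n"
            using mult_left_mono[OF bound_j[OF True l j, of m n], of "norm (coef s)"] True
            by (simp add: T_e[OF j(1)] functional_scale[OF l(1)] norm_mult Q_def mult_ac)
        qed
        also have "\<dots> = Q * (r ^ m * (\<Sum>n\<in>F. ?f n))" by (simp add: sum_distrib_left mult.assoc)
        also have "\<dots> < 1" by (rule small)
        finally show "norm (l (\<Sum>n\<in>F. (T j ^^ m) (e s n))) < 1" .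
      qed
      then show "dist (\<Sum>n\<in>F. (T j ^^ m) (e s n)) 0 < d" by (simp add: dist_commute)
    qed
  qed
  have "adapted_family J T i e"
    unfolding adapted_family_def using dense inverse diag off_diag by (intro conjI ballI allI impI)
  then show ?thesis by blast
qed

end

theorem theorem8p2:
  fixes sm :: "complex \<Rightarrow> 'a::{ab_group_add,complete_space} \<Rightarrow> 'a"
    and N :: nat
    and T :: "nat \<Rightarrow> 'a \<Rightarrow> 'a"
    and E :: "complex \<Rightarrow> 'a"
    and Om :: "complex set"
    and U :: "nat \<Rightarrow> complex set"
    and \<phi> :: "nat \<Rightarrow> complex \<Rightarrow> complex"
  assumes "N \<ge> 2"
    and "frechet_space sm"
    and "\<forall>i\<in>{1..N}. cont_lin_op sm (T i)"
    and "open Om" and "connected Om" and "Om \<noteq> {}"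
    and "vholomorphic_on sm E Om"
    and "\<forall>i\<in>{1..N}. open (U i) \<and> connected (U i) \<and> Om \<subseteq> U i \<and> \<phi> i holomorphic_on U i
            \<and> \<not> (\<exists>c. \<forall>z\<in>U i. \<phi> i z = c)"
    and "closure (module.span sm (E ` Om)) = UNIV"
    and "\<forall>i\<in>{1..N}. \<forall>z\<in>Om. T i (E z) = sm (\<phi> i z) (E z)"
    and "\<forall>i\<in>{1..N}. \<exists>z\<in>Om. \<phi> i z \<in> sphere 0 1 \<and>
            (\<forall>j\<in>{1..N}. j \<noteq> i \<longrightarrow> \<phi> j z \<in> ball 0 1)"
  shows "densely_d_freq_hypercyclic N T"
proof -
  have "vector_space sm" using assms(2) by (simp add: frechet_space_def)
  then interpret frechet sm
    by (intro frechet.intro complex_vector_space.intro frechet_axioms.intro assms(2))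
  have hol: "\<phi> i holomorphic_on Om" if "i \<in> {1..N}" for i
  proof (rule holomorphic_on_subset)
    show "\<phi> i holomorphic_on U i" "Om \<subseteq> U i" using assms(8) that by blast+
  qed
  \<comment> \<open>Nonconstancy is given on the larger domain \<open>U i\<close> and passes to the
    nonempty open subset \<open>Om\<close> by the identity theorem.\<close>
  have nonconst: "\<not> \<phi> i constant_on Om" if i: "i \<in> {1..N}" for i
  proof
    assume "\<phi> i constant_on Om"
    then obtain c where c: "\<And>z. z \<in> Om \<Longrightarrow> \<phi> i z = c" by (auto simp: constant_on_def)
    obtain z1 where z1: "z1 \<in> Om" using assms(6) by blast
    have U: "open (U i)" "connected (U i)" "Om \<subseteq> U i" "\<phi> i holomorphic_on U i"
      "\<not> (\<exists>c. \<forall>z\<in>U i. \<phi> i z = c)" using assms(8) i by blast+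
    have "\<phi> i z - c = 0" if "z \<in> U i" for z
    proof (rule analytic_continuation_open[of Om "U i" "\<lambda>z. \<phi> i z - c" "\<lambda>_. 0"])
      show "(\<lambda>z. \<phi> i z - c) holomorphic_on U i" by (intro holomorphic_intros U)
    qed (use U assms c that z1 in auto)
    with U(5) show False by auto
  qed
  have T: "cont_lin_op sm (T i)" if "i \<in> {1..N}" for i using assms(3) that by blast
  have eigen: "T i (E z) = sm (\<phi> i z) (E z)" if "i \<in> {1..N}" "z \<in> Om" for i z
    using assms(10) that by blast
  have "\<exists>e. adapted_family {1..N} T i e" if i: "i \<in> {1..N}" for i
  proof -
    obtain z where z: "z \<in> Om" "\<phi> i z \<in> sphere 0 1" "\<forall>j\<in>{1..N}. j \<noteq> i \<longrightarrow> \<phi> j z \<in> ball 0 1"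
      using assms(11) i by blast
    then have z': "norm (\<phi> i z) = 1" "\<And>j. j \<in> {1..N} \<Longrightarrow> j \<noteq> i \<Longrightarrow> norm (\<phi> j z) < 1" by auto
    show ?thesis
      by (rule eigenvector_family[where \<phi> = \<phi>, OF finite_atLeastAtMost i T assms(4,5,7,9) eigen hol
            nonconst[OF i] z(1) z'])
  qed
  then obtain e where e: "\<And>i. i \<in> {1..N} \<Longrightarrow> adapted_family {1..N} T i (e i)" by metis
  show ?thesis
    by (rule disjoint_frequent_hypercyclicity_criterion[where e = e, OF _ T e]) (use assms(1) in auto)
qed

end
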